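(* Let $T$ be a polygonal transformation in $\mathbb{P}^d$ admitting a scaling symmetry. Let $P=(p_1,\dots,p_n)$ be a closed $n$-gon and let $(c_{i,j})$ be its cross-ratio coordinates, with deformation $c_{i,j}(t)$ under the scaling symmetry. Then the infinitesimal monodromy of $P$ is $$M'(1): p \mapsto \sum_{i=1}^n\sum_{j=0}^{d}\frac{c_{i,j+1}'(1)}{c_{i,j+1}(1)}\, \frac{\det(p_{i},\dots,p_{i+j-1},p,p_{i+j+1},\dots,p_{i+d})}{\det(p_{i},\dots,p_{i+d})}\,p_{i+j},$$ as an equality in $\mathfrak{pgl}_{d+1}$.
   Context: Let $F$ be a field, $\mathbb{P}^d=\mathbb{P}^d(F)$, $\mathrm{PGL}_{d+1}=\mathrm{GL}_{d+1}(F)/F^*$, $\mathbb{G}_m=F^*$ (as algebraic group). A (twisted) $n$-gon in $\mathbb{P}^d$ is $P=((p_i)_{i\in\mathbb{Z}},M)$ with $p_i\in\mathbb{P}^d$, monodromy $M\in\mathrm{PGL}_{d+1}$, $p_{i+n}=Mp_i$ for all $i$, such that $(p_i,\dots,p_{i+d+1})$ is a projective frame for every $i$. It is closed if $M=\mathrm{Id}$. Let $\tilde{\mathcal T}_n$ be the space of $n$-gons; $\mathrm{PGL}_{d+1}$ acts by $A\cdot P=((Ap_i),AMA^{-1})$, with quotient (moduli space) $\mathcal{T}_n$ and class $[P]$. A polygonal transformation is a birational map $T:\tilde{\mathcal T}_n\dashrightarrow\tilde{\mathcal T}_n$ commuting with this action; it induces a birational map of $\mathcal T_n$, also denoted $T$.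 Cross-ratio coordinates: for a projective frame $(q_0,\dots,q_{d+1})$ let $C_{q_0,\dots,q_{d+1}}$ be the unique projective transformation mapping it to $([1:\dots:1],[1:0:\dots:0],\dots,[0:\dots:0:1])$. The coordinates of $P$ are $c_i=[c_{i,1}:\dots:c_{i,d+1}]:=C_{p_{i-1},p_i,\dots,p_{i+d}}(p_{i+d+1})$, $i\in\mathbb{Z}$ ($n$-periodic in $i$, all $c_{i,j}\neq0$, normalizable by $c_{i,d+1}=1$); they determine $[P]$. A scaling symmetry is a non-trivial action $\rho:\mathbb{G}_m\times\mathcal T_n\to\mathcal T_n$, $(t,[P])\mapsto[P]_t$, of the algebraic group $\mathbb{G}_m$ (rational in $t$ and in the cross-ratio coordinates, undefined where some $c_{i,j}(t)\in\{0,\infty\}$) commuting with $T$. $c_{i,j}(t)$ denotes the coordinates of $[P]_t$ and $'$ denotes the derivative in $t$. A lift of the deformation is an algebraic family $(P_t)$ of $n$-gons with $P_1=P$ and $[P_t]=[P]_t$; let $M(t)$ be the monodromy of $P_t$. For $P$ closed, the infinitesimal monodromy is $M'(1)\in\mathfrak{pgl}_{d+1}=\mathfrak{gl}_{d+1}/F\cdot\mathrm{Id}$ (the tangent vector at $M(1)=\mathrm{Id}$); it does not depend on the lift. In the formula, determinants and sums are computed with any lifts of the points $p_i$ to non-zero vectors of $F^{d+1}$ (the expression does not depend on them), and the right-hand side is a linear operator in $p\in F^{d+1}$. *)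

theory Defs
  imports
    "HOL-Library.Poly_Mapping"
    "HOL-Library.Nat_Bijection"
    "HOL-Computational_Algebra.Polynomial"
    "HOL-Computational_Algebra.Fraction_Field"
    "Jordan_Normal_Form.Matrix"
    "Jordan_Normal_Form.Determinant"
begin

section \<open>Projective geometry in homogeneous coordinates\<close>

text \<open>
  Points of the projective space of dimension \<open>d\<close> are represented by non-zero vectors of
  dimension \<open>Suc d\<close>, elements of the projective linear group by invertible matrices, both up to
  a non-zero scalar. Coordinates of vectors are indexed from 0.
\<close>

definition proj_eq :: "'k::field vec \<Rightarrow> 'k vec \<Rightarrow> bool" where
  "proj_eq v w \<longleftrightarrow> (\<exists>k. k \<noteq> 0 \<and> v = k \<cdot>\<^sub>v w)"

definition proj_eq_mat :: "'k::field mat \<Rightarrow> 'k mat \<Rightarrow> bool" where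
  "proj_eq_mat A B \<longleftrightarrow> (\<exists>k. k \<noteq> 0 \<and> A = k \<cdot>\<^sub>m B)"

text \<open>Any \<open>Suc d\<close> of the \<open>d + 2\<close> points \<open>q 0, \<dots>, q (Suc d)\<close> are given by a basis.\<close>

definition projective_frame :: "nat \<Rightarrow> (nat \<Rightarrow> 'k::field vec) \<Rightarrow> bool" where
  "projective_frame d q \<longleftrightarrow>
     (\<forall>m \<le> Suc d. invertible_mat
        (mat_of_cols (Suc d) (map q (filter (\<lambda>k. k \<noteq> m) [0..<d + 2]))))"

section \<open>Twisted polygons and their moduli\<close>

type_synonym 'k polygon = "(int \<Rightarrow> 'k vec) \<times> 'k mat"

definition ngon :: "nat \<Rightarrow> nat \<Rightarrow> 'k::field polygon \<Rightarrow> bool" where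
  "ngon d n P \<longleftrightarrow> n \<ge> 1 \<and>
     snd P \<in> carrier_mat (Suc d) (Suc d) \<and> invertible_mat (snd P) \<and>
     (\<forall>i. fst P i \<in> carrier_vec (Suc d) \<and> fst P i \<noteq> 0\<^sub>v (Suc d)) \<and>
     (\<forall>i. proj_eq (fst P (i + int n)) (snd P *\<^sub>v fst P i)) \<and>
     (\<forall>i. projective_frame d (\<lambda>k. fst P (i + int k)))"

definition closed_ngon :: "nat \<Rightarrow> nat \<Rightarrow> 'k::field polygon \<Rightarrow> bool" where
  "closed_ngon d n P \<longleftrightarrow> ngon d n P \<and> proj_eq_mat (snd P) (1\<^sub>m (Suc d))"

definition polygon_eq :: "'k::field polygon \<Rightarrow> 'k polygon \<Rightarrow> bool" where
  "polygon_eq P Q \<longleftrightarrow> (\<forall>i. proj_eq (fst P i) (fst Q i)) \<and> proj_eq_mat (snd P) (snd Q)"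

text \<open>The action of the class of \<open>A\<close>, whose inverse \<open>B\<close> is passed as an argument.\<close>

definition transform_polygon :: "'k::field mat \<Rightarrow> 'k mat \<Rightarrow> 'k polygon \<Rightarrow> 'k polygon" where
  "transform_polygon A B P = ((\<lambda>i. A *\<^sub>v fst P i), A * snd P * B)"

text \<open>
  \<open>has_coords d n P c\<close>: for \<open>1 \<le> i \<le> n\<close>, \<open>[c i 1 : \<dots> : c i (d + 1)]\<close> is the cross-ratio
  coordinate of index \<open>i\<close> of \<open>P\<close>. The homogeneous coordinates are not normalized; the
  remaining values of \<open>c\<close> are irrelevant.
\<close>

definition has_coords :: "nat \<Rightarrow> nat \<Rightarrow> 'k::field polygon \<Rightarrow> (nat \<Rightarrow> nat \<Rightarrow> 'k) \<Rightarrow> bool" where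
  "has_coords d n P c \<longleftrightarrow>
     (\<forall>i \<in> {1..n}. \<exists>A \<in> carrier_mat (Suc d) (Suc d). invertible_mat A \<and>
        proj_eq (A *\<^sub>v fst P (int i - 1)) (vec (Suc d) (\<lambda>_. 1)) \<and>
        (\<forall>k \<le> d. proj_eq (A *\<^sub>v fst P (int i + int k)) (unit_vec (Suc d) k)) \<and>
        proj_eq (A *\<^sub>v fst P (int i + int d + 1)) (vec (Suc d) (\<lambda>k. c i (Suc k))))"

text \<open>
  Equality of two points of the moduli space, compared in the normalization in which
  the last entry of each coordinate is 1.
\<close>

definition coords_eq ::
    "nat \<Rightarrow> nat \<Rightarrow> (nat \<Rightarrow> nat \<Rightarrow> 'k::field) \<Rightarrow> (nat \<Rightarrow> nat \<Rightarrow> 'k) \<Rightarrow> bool" where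
  "coords_eq d n c c' \<longleftrightarrow>
     (\<forall>i \<in> {1..n}. \<forall>j \<in> {1..d}. c i j / c i (Suc d) = c' i j / c' i (Suc d))"

section \<open>Rational functions in several variables\<close>

text \<open>
  Variables are indexed by natural numbers. The field \<open>'a ratfun\<close> of rational functions in
  countably many variables over the base field \<open>'a\<close> plays two roles: its elements are the
  components of the rational maps below, and it is the (infinite) extension field over whose
  points identities between rational maps are stated. Since it contains generic points of all
  the varieties involved, such an identity holds as an identity of rational maps over the base
  field, which would not be guaranteed by points over a finite base field.
\<close>

type_synonym 'a mpoly = "(nat \<Rightarrow>\<^sub>0 nat) \<Rightarrow>\<^sub>0 'a"
type_synonym 'a ratfun = "'a mpoly fract"

definition ratfun_const :: "'a::field \<Rightarrow> 'a ratfun" where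
  "ratfun_const a = Fraction_Field.Fract (Poly_Mapping.single 0 a) 1"

text \<open>Evaluation at a point \<open>x\<close> over an extension \<open>h\<close> of the base field.\<close>

definition mpoly_eval :: "('a::field \<Rightarrow> 'k::field) \<Rightarrow> (nat \<Rightarrow> 'k) \<Rightarrow> 'a mpoly \<Rightarrow> 'k" where
  "mpoly_eval h x p =
     (\<Sum>m \<in> Poly_Mapping.keys p. h (Poly_Mapping.lookup p m) *
        (\<Prod>v \<in> Poly_Mapping.keys m. x v ^ Poly_Mapping.lookup m v))"

text \<open>\<open>f\<close> is regular at \<open>x\<close> and takes the value \<open>y\<close> there.\<close>

definition ratfun_val ::
    "('a::field \<Rightarrow> 'k::field) \<Rightarrow> 'a ratfun \<Rightarrow> (nat \<Rightarrow> 'k) \<Rightarrow> 'k \<Rightarrow> bool" where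
  "ratfun_val h f x y \<longleftrightarrow>
     (\<exists>N D. f = Fraction_Field.Fract N D \<and> mpoly_eval h x D \<noteq> 0 \<and>
        y = mpoly_eval h x N / mpoly_eval h x D)"

section \<open>Polygonal transformations\<close>

text \<open>
  A rational map on the space of \<open>n\<close>-gons is given by rational functions
  \<open>fst T k a\<close> (component \<open>a\<close> of the \<open>k\<close>-th vertex of the image, \<open>1 \<le> k \<le> n\<close>) and
  \<open>snd T a b\<close> (entries of the monodromy of the image) in the homogeneous coordinates of the
  vertices with indices \<open>1, \<dots>, n\<close> and the entries of the monodromy. The variable with number
  \<open>prod_encode (k, a)\<close>, \<open>k \<ge> 1\<close>, is component \<open>a\<close> of vertex \<open>k\<close>, and the variable with number
  \<open>prod_encode (0, prod_encode (a, b))\<close> is entry \<open>(a, b)\<close> of the monodromy.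
\<close>

type_synonym 'a rational_polygon_map =
  "(nat \<Rightarrow> nat \<Rightarrow> 'a ratfun) \<times> (nat \<Rightarrow> nat \<Rightarrow> 'a ratfun)"

definition polygon_point :: "nat \<Rightarrow> nat \<Rightarrow> 'k::field polygon \<Rightarrow> nat \<Rightarrow> 'k" where
  "polygon_point d n P v =
     (case prod_decode v of (k, a) \<Rightarrow>
        if k = 0
        then (case prod_decode a of (r, s) \<Rightarrow>
                if r \<le> d \<and> s \<le> d then snd P $$ (r, s) else 0)
        else if k \<le> n \<and> a \<le> d then fst P (int k) $ a else 0)"

definition maps_polygon ::
    "nat \<Rightarrow> nat \<Rightarrow> 'a::field rational_polygon_map \<Rightarrow> 'a ratfun polygon \<Rightarrow> 'a ratfun polygon \<Rightarrow> bool"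
  where
  "maps_polygon d n T P Q \<longleftrightarrow> ngon d n P \<and> ngon d n Q \<and>
     (\<forall>k \<in> {1..n}. \<exists>v \<in> carrier_vec (Suc d).
        (\<forall>a \<le> d. ratfun_val ratfun_const (fst T k a) (polygon_point d n P) (v $ a)) \<and>
        proj_eq (fst Q (int k)) v) \<and>
     (\<exists>N \<in> carrier_mat (Suc d) (Suc d).
        (\<forall>a \<le> d. \<forall>b \<le> d.
           ratfun_val ratfun_const (snd T a b) (polygon_point d n P) (N $$ (a, b))) \<and>
        proj_eq_mat (snd Q) N)"

text \<open>
  Defined somewhere, hence on a dense open set, and independent of the choice of
  homogeneous coordinates.
\<close>

definition rational_map :: "nat \<Rightarrow> nat \<Rightarrow> 'a::field rational_polygon_map \<Rightarrow> bool" where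
  "rational_map d n T \<longleftrightarrow>
     (\<exists>P Q. maps_polygon d n T P Q) \<and>
     (\<forall>P P' Q Q'. maps_polygon d n T P Q \<and> maps_polygon d n T P' Q' \<and> polygon_eq P P'
        \<longrightarrow> polygon_eq Q Q')"

text \<open>The composition of first \<open>T\<close>, then \<open>S\<close> is defined and is the identity.\<close>

definition left_inverse_map ::
    "nat \<Rightarrow> nat \<Rightarrow> 'a::field rational_polygon_map \<Rightarrow> 'a rational_polygon_map \<Rightarrow> bool" where
  "left_inverse_map d n S T \<longleftrightarrow>
     (\<exists>P Q R. maps_polygon d n T P Q \<and> maps_polygon d n S Q R) \<and>
     (\<forall>P Q R. maps_polygon d n T P Q \<and> maps_polygon d n S Q R \<longrightarrow> polygon_eq R P)"

definition birational_map :: "nat \<Rightarrow> nat \<Rightarrow> 'a::field rational_polygon_map \<Rightarrow> bool" where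
  "birational_map d n T \<longleftrightarrow> rational_map d n T \<and>
     (\<exists>S. rational_map d n S \<and> left_inverse_map d n S T \<and> left_inverse_map d n T S)"

definition polygonal_transformation ::
    "nat \<Rightarrow> nat \<Rightarrow> 'a::field rational_polygon_map \<Rightarrow> bool" where
  "polygonal_transformation d n T \<longleftrightarrow> birational_map d n T \<and>
     (\<forall>A \<in> carrier_mat (Suc d) (Suc d). \<forall>B \<in> carrier_mat (Suc d) (Suc d).
        A * B = 1\<^sub>m (Suc d) \<and> B * A = 1\<^sub>m (Suc d) \<longrightarrow>
        (\<forall>P Q Q'. maps_polygon d n T P Q \<and> maps_polygon d n T (transform_polygon A B P) Q'
           \<longrightarrow> polygon_eq Q' (transform_polygon A B Q)))"

section \<open>Scaling symmetries\<close>

text \<open>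
  A rational map from the product of the multiplicative group with the moduli space to the
  moduli space is given by rational functions \<open>\<rho> i j\<close>, \<open>1 \<le> i \<le> n\<close>, \<open>1 \<le> j \<le> d\<close>, the normalized
  coordinates of the image, in the parameter \<open>t\<close> (variable \<open>prod_encode (0, 0)\<close>) and the
  normalized coordinates of the argument (variables \<open>prod_encode (i, j)\<close>). It is regarded as
  undefined where one of the coordinates of the image is 0 or infinite.
\<close>

definition moduli_point :: "nat \<Rightarrow> nat \<Rightarrow> 'k::field \<Rightarrow> (nat \<Rightarrow> nat \<Rightarrow> 'k) \<Rightarrow> nat \<Rightarrow> 'k" where
  "moduli_point d n t c v =
     (case prod_decode v of (i, j) \<Rightarrow>
        if i = 0 \<and> j = 0 then t
        else if i \<in> {1..n} \<and> j \<in> {1..d} then c i j / c i (Suc d) else 0)"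

definition maps_moduli ::
    "('a::field \<Rightarrow> 'k::field) \<Rightarrow> nat \<Rightarrow> nat \<Rightarrow> (nat \<Rightarrow> nat \<Rightarrow> 'a ratfun) \<Rightarrow> 'k \<Rightarrow>
      (nat \<Rightarrow> nat \<Rightarrow> 'k) \<Rightarrow> (nat \<Rightarrow> nat \<Rightarrow> 'k) \<Rightarrow> bool" where
  "maps_moduli h d n \<rho> t c c' \<longleftrightarrow> t \<noteq> 0 \<and>
     (\<forall>i \<in> {1..n}. \<forall>j \<in> {1..Suc d}. c i j \<noteq> 0 \<and> c' i j \<noteq> 0) \<and>
     (\<forall>i \<in> {1..n}. \<forall>j \<in> {1..d}.
        ratfun_val h (\<rho> i j) (moduli_point d n t c) (c' i j / c' i (Suc d)))"

text \<open>
  A rational, non-trivial action of the multiplicative group. The existential clause says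
  that the map is defined at some point with \<open>t = 1\<close>.
\<close>

definition scaling_action :: "nat \<Rightarrow> nat \<Rightarrow> (nat \<Rightarrow> nat \<Rightarrow> 'a::field ratfun) \<Rightarrow> bool" where
  "scaling_action d n \<rho> \<longleftrightarrow>
     (\<exists>c c'. maps_moduli ratfun_const d n \<rho> 1 c c') \<and>
     (\<forall>c c'. maps_moduli ratfun_const d n \<rho> 1 c c' \<longrightarrow> coords_eq d n c' c) \<and>
     (\<forall>s t c c' e e'. maps_moduli ratfun_const d n \<rho> t c c' \<and>
        maps_moduli ratfun_const d n \<rho> s c' e \<and> maps_moduli ratfun_const d n \<rho> (s * t) c e'
        \<longrightarrow> coords_eq d n e e') \<and>
     (\<exists>t c c'. maps_moduli ratfun_const d n \<rho> t c c' \<and> \<not> coords_eq d n c' c)"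

text \<open>
  The last clause says that the map induced by \<open>T\<close> on the moduli space commutes with the
  action: if \<open>T\<close> maps \<open>P\<close> to \<open>Q\<close> and \<open>P'\<close> to \<open>Q'\<close>, and \<open>[P'] = [P]\<^sub>t\<close>, then \<open>[Q'] = [Q]\<^sub>t\<close>.
\<close>

definition scaling_symmetry ::
    "nat \<Rightarrow> nat \<Rightarrow> 'a::field rational_polygon_map \<Rightarrow> (nat \<Rightarrow> nat \<Rightarrow> 'a ratfun) \<Rightarrow> bool" where
  "scaling_symmetry d n T \<rho> \<longleftrightarrow> scaling_action d n \<rho> \<and>
     (\<forall>t P P' Q Q' c c' e e'.
        maps_polygon d n T P Q \<and> maps_polygon d n T P' Q' \<and>
        has_coords d n P c \<and> has_coords d n P' c' \<and> has_coords d n Q e \<and>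
        maps_moduli ratfun_const d n \<rho> t c c' \<and> maps_moduli ratfun_const d n \<rho> t e e'
        \<longrightarrow> has_coords d n Q' e')"

section \<open>Rational families and their derivatives\<close>

text \<open>
  Families depending rationally on \<open>t\<close> are objects over the field \<open>'a poly fract\<close> of rational
  functions in \<open>t\<close>.
\<close>

definition fam_const :: "'a::field \<Rightarrow> 'a poly fract" where
  "fam_const a = Fraction_Field.Fract [:a:] 1"

definition fam_t :: "'a::field poly fract" where
  "fam_t = Fraction_Field.Fract [:0, 1:] 1"

definition regular_at :: "'a::field \<Rightarrow> 'a poly fract \<Rightarrow> bool" where
  "regular_at a f \<longleftrightarrow> (\<exists>N D. f = Fraction_Field.Fract N D \<and> poly D a \<noteq> 0)"

definition eval_at :: "'a::field \<Rightarrow> 'a poly fract \<Rightarrow> 'a" where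
  "eval_at a f =
     (THE y. \<exists>N D. f = Fraction_Field.Fract N D \<and> poly D a \<noteq> 0 \<and> y = poly N a / poly D a)"

lemma eval_at_Fract:
  assumes "poly D a \<noteq> 0"
  shows "eval_at a (Fraction_Field.Fract N D) = poly N a / poly D a"
  unfolding eval_at_def
proof (rule the_equality)
  show "\<exists>N' D'. Fraction_Field.Fract N D = Fraction_Field.Fract N' D' \<and> poly D' a \<noteq> 0 \<and>
          poly N a / poly D a = poly N' a / poly D' a"
    using assms by blast
next
  fix y
  assume "\<exists>N' D'. Fraction_Field.Fract N D = Fraction_Field.Fract N' D' \<and> poly D' a \<noteq> 0 \<and>
            y = poly N' a / poly D' a"
  then obtain N' D' where eq: "Fraction_Field.Fract N D = Fraction_Field.Fract N' D'"
    and D': "poly D' a \<noteq> 0" and y: "y = poly N' a / poly D' a" by blast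
  have "D \<noteq> 0" "D' \<noteq> 0" using assms D' by auto
  with eq have "N * D' = N' * D" by (simp add: eq_fract)
  then have "poly N a * poly D' a = poly N' a * poly D a" by (metis poly_mult)
  then show "y = poly N a / poly D a" using y assms D' by (simp add: frac_eq_eq)
qed

text \<open>The formal derivative with respect to \<open>t\<close>, by the quotient rule.\<close>

definition fam_deriv :: "'a::field poly fract \<Rightarrow> 'a poly fract" where
  "fam_deriv f = (THE g. \<exists>N D. f = Fraction_Field.Fract N D \<and> D \<noteq> 0 \<and>
     g = Fraction_Field.Fract (pderiv N * D - N * pderiv D) (D ^ 2))"

lemma fam_deriv_Fract:
  fixes N D :: "'a::field poly"
  assumes "D \<noteq> 0"
  shows "fam_deriv (Fraction_Field.Fract N D) =
    Fraction_Field.Fract (pderiv N * D - N * pderiv D) (D ^ 2)"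
  unfolding fam_deriv_def
proof (rule the_equality)
  show "\<exists>N' D'. Fraction_Field.Fract N D = Fraction_Field.Fract N' D' \<and> D' \<noteq> 0 \<and>
          Fraction_Field.Fract (pderiv N * D - N * pderiv D) (D ^ 2) =
          Fraction_Field.Fract (pderiv N' * D' - N' * pderiv D') (D' ^ 2)"
    using assms by blast
next
  fix g
  assume "\<exists>N' D'. Fraction_Field.Fract N D = Fraction_Field.Fract N' D' \<and> D' \<noteq> 0 \<and>
            g = Fraction_Field.Fract (pderiv N' * D' - N' * pderiv D') (D' ^ 2)"
  then obtain N' D' where "Fraction_Field.Fract N D = Fraction_Field.Fract N' D'"
    and nz: "D' \<noteq> 0"
    and g: "g = Fraction_Field.Fract (pderiv N' * D' - N' * pderiv D') (D' ^ 2)" by blast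
  then have eq: "N * D' = N' * D" using assms by (simp add: eq_fract)
  then have "pderiv (N * D') = pderiv (N' * D)" by simp
  then have "N * pderiv D' + D' * pderiv N = N' * pderiv D + D * pderiv N'"
    by (simp add: pderiv_mult)
  then have d: "D' * pderiv N = N' * pderiv D + D * pderiv N' - N * pderiv D'"
    by (metis add_diff_cancel_left')
  have "(pderiv N * D - N * pderiv D) * D' ^ 2 =
      D * D' * (D' * pderiv N) - pderiv D * D' * (N * D')"
    by (simp add: algebra_simps power2_eq_square)
  also have "\<dots> = D * D' * (N' * pderiv D + D * pderiv N' - N * pderiv D') - pderiv D * D' * (N' * D)"
    by (simp only: d eq)
  also have "\<dots> = D * D * D' * pderiv N' - D * pderiv D' * (N * D')"
    by (simp add: algebra_simps)
  also have "\<dots> = (pderiv N' * D' - N' * pderiv D') * D ^ 2"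
    by (simp only: eq) (simp add: algebra_simps power2_eq_square)
  finally show "g = Fraction_Field.Fract (pderiv N * D - N * pderiv D) (D ^ 2)"
    using g nz assms by (simp add: eq_fract)
qed

section \<open>Deformations and the infinitesimal monodromy\<close>

text \<open>
  \<open>C\<close> gives the coordinates \<open>c\<^bsub>i,j\<^esub>(t)\<close> of \<open>[P]\<^sub>t\<close>, where \<open>c\<close> gives those of \<open>[P]\<close>. As \<open>\<rho>\<close> is
  only a rational map, \<open>[P]\<^sub>1 = [P]\<close> has to be understood to include that \<open>\<rho>\<close> is defined there.
  The homogeneous coordinates \<open>C i\<close> need not be normalized, but have to be defined
  and non-zero at \<open>t = 1\<close>.
\<close>

definition deformation ::
    "nat \<Rightarrow> nat \<Rightarrow> (nat \<Rightarrow> nat \<Rightarrow> 'a::field ratfun) \<Rightarrow> (nat \<Rightarrow> nat \<Rightarrow> 'a) \<Rightarrow>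
      (nat \<Rightarrow> nat \<Rightarrow> 'a poly fract) \<Rightarrow> bool" where
  "deformation d n \<rho> c C \<longleftrightarrow>
     maps_moduli (\<lambda>a. a) d n \<rho> 1 c c \<and>
     maps_moduli fam_const d n \<rho> fam_t (\<lambda>i j. fam_const (c i j)) C \<and>
     (\<forall>i \<in> {1..n}. \<forall>j \<in> {1..Suc d}. regular_at 1 (C i j) \<and> eval_at 1 (C i j) \<noteq> 0)"

definition lift_of_deformation ::
    "nat \<Rightarrow> nat \<Rightarrow> 'a::field polygon \<Rightarrow> (nat \<Rightarrow> nat \<Rightarrow> 'a poly fract) \<Rightarrow> 'a poly fract polygon \<Rightarrow> bool"
  where
  "lift_of_deformation d n P C Pt \<longleftrightarrow> ngon d n Pt \<and>
     (\<forall>i. \<forall>a \<le> d. regular_at 1 (fst Pt i $ a)) \<and>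
     (\<forall>a \<le> d. \<forall>b \<le> d. regular_at 1 (snd Pt $$ (a, b))) \<and>
     polygon_eq ((\<lambda>i. map_vec (eval_at 1) (fst Pt i)), map_mat (eval_at 1) (snd Pt)) P \<and>
     has_coords d n Pt C"

text \<open>
  For a family \<open>M\<close> of matrices with \<open>M(1) = \<mu> \<cdot> Id\<close>, the tangent vector at \<open>t = 1\<close> of the family
  of projective transformations given by \<open>M\<close> is represented by \<open>M'(1) / \<mu>\<close>.
\<close>

definition tangent_at_identity :: "'a::field poly fract mat \<Rightarrow> 'a mat" where
  "tangent_at_identity M =
     inverse (eval_at 1 (M $$ (0, 0))) \<cdot>\<^sub>m map_mat (\<lambda>f. eval_at 1 (fam_deriv f)) M"

text \<open>\<open>det_replace d p i j v\<close> is \<open>det(p\<^sub>i, \<dots>, p\<^bsub>i+j-1\<^esub>, v, p\<^bsub>i+j+1\<^esub>, \<dots>, p\<^bsub>i+d\<^esub>)\<close>.\<close>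

definition det_replace :: "nat \<Rightarrow> (int \<Rightarrow> 'a::field vec) \<Rightarrow> nat \<Rightarrow> nat \<Rightarrow> 'a vec \<Rightarrow> 'a" where
  "det_replace d p i j v =
     det (mat_of_cols (Suc d) (map (\<lambda>k. if k = j then v else p (int (i + k))) [0..<Suc d]))"

definition det_points :: "nat \<Rightarrow> (int \<Rightarrow> 'a::field vec) \<Rightarrow> nat \<Rightarrow> 'a" where
  "det_points d p i = det (mat_of_cols (Suc d) (map (\<lambda>k. p (int (i + k))) [0..<Suc d]))"

definition monodromy_formula ::
    "nat \<Rightarrow> nat \<Rightarrow> (int \<Rightarrow> 'a::field vec) \<Rightarrow> (nat \<Rightarrow> nat \<Rightarrow> 'a poly fract) \<Rightarrow> 'a vec \<Rightarrow> 'a vec" where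
  "monodromy_formula d n p C v =
     vec (Suc d) (\<lambda>a. \<Sum>i = 1..n. \<Sum>j = 0..d.
       eval_at 1 (fam_deriv (C i (j + 1))) / eval_at 1 (C i (j + 1)) *
       (det_replace d p i j v / det_points d p i) * p (int (i + j)) $ a)"

end

theory Submission
  imports Defs
begin

text \<open>
  Differentiate a lift \<open>(p\<^sub>i(t), M(t))\<close> of the deformation at \<open>t = 1\<close>. Any \<open>d + 2\<close> consecutive
  vertices form a projective frame, so there is exactly one infinitesimal projective transformation
  whose vector field has at each of these vertices the velocity of the vertex. Let \<open>Y\<^sub>i\<close> be the one
  that belongs to the frame \<open>p\<^bsub>i-1\<^esub>, \<dots>, p\<^bsub>i+d\<^esub>\<close>.

  The coordinates \<open>c\<^sub>i\<close> are the coordinates of the next vertex \<open>p\<^bsub>i+d+1\<^esub>\<close> with respect to this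
  frame. If they were constant, \<open>Y\<^sub>i\<close> would also give the velocity of \<open>p\<^bsub>i+d+1\<^esub>\<close>. In general, the
  operator \<open>L\<^sub>i\<close> with \<open>L\<^sub>i p\<^bsub>i+j\<^esub> = (c\<^bsub>i,j+1\<^esub>' / c\<^bsub>i,j+1\<^esub>) p\<^bsub>i+j\<^esub>\<close> for \<open>0 \<le> j \<le> d\<close> has to be added: its
  vector field vanishes at the vertices \<open>p\<^sub>i, \<dots>, p\<^bsub>i+d\<^esub>\<close>, and at \<open>p\<^bsub>i+d+1\<^esub>\<close> it is the velocity caused
  by the change of the coordinates. Therefore \<open>Y\<^sub>i + L\<^sub>i\<close> belongs to the next frame, that is,
  \<open>Y\<^bsub>i+1\<^esub> = Y\<^sub>i + L\<^sub>i\<close> modulo scalars (lemmas \<open>tracks_frame_step\<close> and \<open>tracks_frame_unique\<close>), and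
  \<open>Y\<^bsub>n+1\<^esub> = Y\<^sub>1 + L\<^sub>1 + \<dots> + L\<^sub>n\<close>.

  On the other hand \<open>p\<^bsub>i+n\<^esub>(t) = M(t) p\<^sub>i(t)\<close> with \<open>M(1) = Id\<close> gives \<open>Y\<^bsub>n+1\<^esub> = Y\<^sub>1 + M'(1)\<close> (lemma
  \<open>tracks_monodromy_image\<close>). Comparing both expressions yields \<open>M'(1) = L\<^sub>1 + \<dots> + L\<^sub>n\<close> modulo
  scalars, and by Cramer's rule the right-hand side is the sum of determinant quotients
  (lemma \<open>dual_frame_operator\<close>).

  For the derivatives to make sense, everything has to be regular at \<open>t = 1\<close>. The matrices that
  define the cross-ratio coordinates of the family are arbitrary over the field of rational
  functions in \<open>t\<close>; lemma \<open>moving_frame\<close> provides regular ones, which remain invertible at \<open>t = 1\<close>,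
  and lemma \<open>next_frame_point\<close> allows to use them instead.
\<close>

section \<open>Vectors and matrices over a field\<close>

lemma inverse_matE:
  fixes A :: "'a::field mat"
  assumes A: "A \<in> carrier_mat n n" and "det A \<noteq> 0"
  obtains B where "B \<in> carrier_mat n n" "A * B = 1\<^sub>m n" "B * A = 1\<^sub>m n"
  using det_non_zero_imp_unit[OF assms, of "()"] unfolding Units_def ring_mat_def by auto

lemma invertible_mat_iff_det:
  fixes A :: "'a::field mat"
  assumes A: "A \<in> carrier_mat n n"
  shows "invertible_mat A \<longleftrightarrow> det A \<noteq> 0"
proof
  assume "invertible_mat A"
  then obtain B where "A * B = 1\<^sub>m n" "B * A = 1\<^sub>m (dim_row B)"
    using A unfolding invertible_mat_def inverts_mat_def by auto
  moreover from this have "B \<in> carrier_mat n n"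
    using A by (metis carrier_matD(2) carrier_matI index_mult_mat(3) index_one_mat(3))
  ultimately show "det A \<noteq> 0"
    using det_mult[OF A] by (metis det_one mult_zero_left zero_neq_one)
next
  assume "det A \<noteq> 0"
  from det_non_zero_imp_unit[OF A this, of "()"]
  obtain B where "B \<in> carrier_mat n n" "A * B = 1\<^sub>m n" "B * A = 1\<^sub>m n"
    unfolding Units_def ring_mat_def by auto
  then show "invertible_mat A"
    using A unfolding invertible_mat_def inverts_mat_def by auto
qed

lemma inverse_mult_mat_vec:
  fixes W U :: "'a::semiring_1 mat"
  assumes "U \<in> carrier_mat n n" "W \<in> carrier_mat n n" "U * W = 1\<^sub>m n" "x \<in> carrier_vec n"
  shows "U *\<^sub>v (W *\<^sub>v x) = x"
  using assms by (simp flip: assoc_mult_mat_vec)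

lemma det_nonzero_mult_vec_nonzero:
  fixes A :: "'a::field mat"
  assumes "A \<in> carrier_mat n n" "det A \<noteq> 0" "x \<in> carrier_vec n" "x \<noteq> 0\<^sub>v n"
  shows "A *\<^sub>v x \<noteq> 0\<^sub>v n"
  using assms det_0_iff_vec_prod_zero_field by blast

lemma mult_mat_vec_index:
  assumes "A \<in> carrier_mat m n" "v \<in> carrier_vec n" "a < m"
  shows "(A *\<^sub>v v) $ a = (\<Sum>k<n. A $$ (a, k) * v $ k)"
  using assms by (simp add: scalar_prod_def atLeast0LessThan)

lemma smult_mat_mult_vec:
  fixes A :: "'a::comm_semiring_0 mat"
  assumes "A \<in> carrier_mat m n" "v \<in> carrier_vec n"
  shows "(k \<cdot>\<^sub>m A) *\<^sub>v v = k \<cdot>\<^sub>v (A *\<^sub>v v)"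
  using assms by (intro eq_vecI) auto

lemma mult_unit_vec_eq_col:
  fixes A :: "'a::semiring_1 mat"
  assumes "A \<in> carrier_mat m n" "k < n"
  shows "A *\<^sub>v unit_vec n k = col A k"
  using assms by (intro eq_vecI) auto

lemma cancel_smult_vec:
  fixes u v w :: "'a::field vec"
  assumes "g \<cdot>\<^sub>v u = g' \<cdot>\<^sub>v v + g \<cdot>\<^sub>v w" "g \<noteq> 0"
    and "u \<in> carrier_vec n" "v \<in> carrier_vec n" "w \<in> carrier_vec n"
  shows "u = w + (g' / g) \<cdot>\<^sub>v v"
proof (rule eq_vecI)
  fix a assume "a < dim_vec (w + (g' / g) \<cdot>\<^sub>v v)"
  then have a: "a < n" using assms by simp
  have "g * u $ a = g' * v $ a + g * w $ a"
    using arg_cong[OF assms(1), of "\<lambda>v. v $ a"] a assms(3-) by simp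
  then show "u $ a = (w + (g' / g) \<cdot>\<^sub>v v) $ a"
    using a assms(2-) by (simp add: field_simps)
qed (use assms in simp)

lemma vec_add_left_cancel:
  fixes u v w :: "'a::cancel_semigroup_add vec"
  assumes "u + v = u + w" "u \<in> carrier_vec n" "v \<in> carrier_vec n" "w \<in> carrier_vec n"
  shows "v = w"
proof (rule eq_vecI)
  fix a assume "a < dim_vec w"
  then show "v $ a = w $ a"
    using arg_cong[OF assms(1), of "\<lambda>x. x $ a"] assms(2-) by simp
qed (use assms in simp)

lemma diagonal_mult_vec:
  fixes f :: "nat \<Rightarrow> 'a::semiring_0"
  assumes "x \<in> carrier_vec n"
  shows "mat n n (\<lambda>(a, b). if a = b then f a else 0) *\<^sub>v x = vec n (\<lambda>a. f a * x $ a)"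
proof (rule eq_vecI)
  fix a assume "a < dim_vec (vec n (\<lambda>a. f a * x $ a))"
  then have a: "a < n" by simp
  have "(mat n n (\<lambda>(a, b). if a = b then f a else 0) *\<^sub>v x) $ a =
      (\<Sum>k<n. (if a = k then f a else 0) * x $ k)"
    using assms a by (subst mult_mat_vec_index[of _ n n]) auto
  also have "\<dots> = (\<Sum>k<n. if a = k then f a * x $ k else 0)"
    by (intro sum.cong) auto
  also have "\<dots> = f a * x $ a" using a by simp
  finally show "(mat n n (\<lambda>(a, b). if a = b then f a else 0) *\<^sub>v x) $ a =
      vec n (\<lambda>a. f a * x $ a) $ a" using a by simp
qed simp

lemma eigenbasis_mult_vec:
  fixes L W :: "'a::field mat"
  assumes L: "L \<in> carrier_mat n n" and W: "W \<in> carrier_mat n n"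
    and eig: "\<And>k. k < n \<Longrightarrow> L *\<^sub>v (W *\<^sub>v unit_vec n k) = f k \<cdot>\<^sub>v (W *\<^sub>v unit_vec n k)"
    and x: "x \<in> carrier_vec n"
  shows "L *\<^sub>v (W *\<^sub>v x) = W *\<^sub>v vec n (\<lambda>k. f k * x $ k)"
proof -
  let ?D = "mat n n (\<lambda>(a, b). if a = b then f a else 0)"
  have "L * W = W * ?D"
  proof (rule mat_col_eqI)
    fix k assume "k < dim_col (W * ?D)"
    then have k: "k < n" by simp
    have "col (L * W) k = L *\<^sub>v (W *\<^sub>v unit_vec n k)"
      using L W k by (simp add: col_mult2[of _ n n _ n] mult_unit_vec_eq_col[of _ n])
    also have "\<dots> = W *\<^sub>v (f k \<cdot>\<^sub>v unit_vec n k)"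
      unfolding eig[OF k] using W by (intro mult_mat_vec[symmetric]) auto
    also have "f k \<cdot>\<^sub>v unit_vec n k = col ?D k"
      using k by (intro eq_vecI) auto
    also have "W *\<^sub>v col ?D k = col (W * ?D) k"
      using W k by (simp add: col_mult2[of _ n n _ n])
    finally show "col (L * W) k = col (W * ?D) k" .
  qed (use L W in auto)
  then have "L *\<^sub>v (W *\<^sub>v x) = W *\<^sub>v (?D *\<^sub>v x)"
    using L W x by (metis (no_types, lifting) assoc_mult_mat_vec mat_carrier)
  then show ?thesis unfolding diagonal_mult_vec[OF x] .
qed

section \<open>Projective frames\<close>

lemma mat_of_cols_mult_vec:
  fixes vs :: "'a::comm_semiring_0 vec list"
  assumes "\<And>k. k < length vs \<Longrightarrow> vs ! k \<in> carrier_vec n" "x \<in> carrier_vec (length vs)" "a < n"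
  shows "(mat_of_cols n vs *\<^sub>v x) $ a = (\<Sum>k<length vs. x $ k * vs ! k $ a)"
  using assms
  by (auto simp: scalar_prod_def mat_of_cols_index atLeast0LessThan intro!: sum.cong)
     (simp add: mult.commute)

lemma det_mat_of_cols_nonzero_iff:
  fixes q :: "nat \<Rightarrow> 'a::field vec"
  assumes "distinct ks" "length ks = n" "\<And>k. k \<in> set ks \<Longrightarrow> q k \<in> carrier_vec n"
  shows "det (mat_of_cols n (map q ks)) \<noteq> 0 \<longleftrightarrow>
    (\<forall>x. (\<forall>a<n. (\<Sum>k\<in>set ks. x k * q k $ a) = 0) \<longrightarrow> (\<forall>k\<in>set ks. x k = 0))"
proof -
  let ?B = "mat_of_cols n (map q ks)"
  have B: "?B \<in> carrier_mat n n" using assms(2) by auto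
  have ix: "(?B *\<^sub>v vec n (\<lambda>l. x (ks ! l))) $ a = (\<Sum>k\<in>set ks. x k * q k $ a)" if "a < n" for x a
  proof -
    have "(?B *\<^sub>v vec n (\<lambda>l. x (ks ! l))) $ a = (\<Sum>l<n. x (ks ! l) * q (ks ! l) $ a)"
      using that assms by (subst mat_of_cols_mult_vec) (auto intro!: sum.cong)
    also have "\<dots> = (\<Sum>k\<in>set ks. x k * q k $ a)"
      using bij_betw_nth[OF assms(1) refl refl] assms(2)
      by (intro sum.reindex_bij_betw[of "\<lambda>l. ks ! l"]) simp
    finally show ?thesis .
  qed
  show ?thesis
  proof
    assume "det ?B \<noteq> 0"
    then have inj: "v = 0\<^sub>v n" if "v \<in> carrier_vec n" "?B *\<^sub>v v = 0\<^sub>v n" for v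
      using det_0_iff_vec_prod_zero_field[OF B] that by blast
    show "\<forall>x. (\<forall>a<n. (\<Sum>k\<in>set ks. x k * q k $ a) = 0) \<longrightarrow> (\<forall>k\<in>set ks. x k = 0)"
    proof (intro allI impI ballI)
      fix x k assume "\<forall>a<n. (\<Sum>k\<in>set ks. x k * q k $ a) = 0" and k: "k \<in> set ks"
      then have "?B *\<^sub>v vec n (\<lambda>l. x (ks ! l)) = 0\<^sub>v n"
        using B ix by (intro eq_vecI) auto
      from inj[OF _ this] have "\<forall>l<n. vec n (\<lambda>l. x (ks ! l)) $ l = 0" by simp
      then show "x k = 0" using k assms(2) by (auto simp: in_set_conv_nth)
    qed
  next
    assume ind: "\<forall>x. (\<forall>a<n. (\<Sum>k\<in>set ks. x k * q k $ a) = 0) \<longrightarrow> (\<forall>k\<in>set ks. x k = 0)"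
    show "det ?B \<noteq> 0"
    proof
      assume "det ?B = 0"
      then obtain v where v: "v \<in> carrier_vec n" "v \<noteq> 0\<^sub>v n" "?B *\<^sub>v v = 0\<^sub>v n"
        using det_0_iff_vec_prod_zero_field[OF B] by blast
      define x where "x k = v $ (the_inv_into {..<n} (\<lambda>l. ks ! l) k)" for k
      have inj: "inj_on (\<lambda>l. ks ! l) {..<n}"
        using assms by (simp add: inj_on_def nth_eq_iff_index_eq)
      have vx: "v = vec n (\<lambda>l. x (ks ! l))"
        using v(1) inj by (intro eq_vecI) (auto simp: x_def the_inv_into_f_f)
      have "\<forall>a<n. (\<Sum>k\<in>set ks. x k * q k $ a) = 0"
        using v(3) ix[of _ x] unfolding vx[symmetric] by simp
      with ind have "\<forall>k\<in>set ks. x k = 0" by blast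
      with assms(2) have "v = 0\<^sub>v n" by (subst vx) (auto intro!: eq_vecI)
      with v(2) show False ..
    qed
  qed
qed

text \<open>
  The \<open>d + 2\<close> vectors satisfy exactly one linear relation up to scalars, and all its coefficients
  are non-zero. In this form, the notion of a frame is easily transported along rescalings of the
  points.
\<close>

lemma projective_frame_iff:
  fixes q :: "nat \<Rightarrow> 'a::field vec"
  assumes "\<And>k. k \<le> Suc d \<Longrightarrow> q k \<in> carrier_vec (Suc d)"
  shows "projective_frame d q \<longleftrightarrow>
    (\<forall>m\<le>Suc d. \<forall>x. (\<forall>a\<le>d. (\<Sum>k\<in>{..Suc d} - {m}. x k * q k $ a) = 0) \<longrightarrow>
       (\<forall>k\<in>{..Suc d} - {m}. x k = 0))"
proof -
  have "invertible_mat (mat_of_cols (Suc d) (map q (filter (\<lambda>k. k \<noteq> m) [0..<d + 2]))) \<longleftrightarrow>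
    (\<forall>x. (\<forall>a\<le>d. (\<Sum>k\<in>{..Suc d} - {m}. x k * q k $ a) = 0) \<longrightarrow>
       (\<forall>k\<in>{..Suc d} - {m}. x k = 0))" if "m \<le> Suc d" for m
  proof -
    let ?ks = "filter (\<lambda>k. k \<noteq> m) [0..<d + 2]"
    have set: "set ?ks = {..Suc d} - {m}" by auto
    have "length ?ks = card (set ?ks)" by (rule distinct_card[symmetric]) simp
    then have len: "length ?ks = Suc d" unfolding set using that by simp
    have "mat_of_cols (Suc d) (map q ?ks) \<in> carrier_mat (Suc d) (Suc d)"
      by (rule carrier_matI) (simp_all only: mat_of_cols_carrier length_map len)
    then have "invertible_mat (mat_of_cols (Suc d) (map q ?ks)) \<longleftrightarrow>
        det (mat_of_cols (Suc d) (map q ?ks)) \<noteq> 0"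
      by (rule invertible_mat_iff_det)
    also have "\<dots> \<longleftrightarrow> (\<forall>x. (\<forall>a<Suc d. (\<Sum>k\<in>set ?ks. x k * q k $ a) = 0) \<longrightarrow>
        (\<forall>k\<in>set ?ks. x k = 0))"
      using len assms set by (intro det_mat_of_cols_nonzero_iff) (simp_all del: upt_Suc)
    finally show ?thesis unfolding set less_Suc_eq_le .
  qed
  then show ?thesis unfolding projective_frame_def by blast
qed

lemma projective_frame_independent:
  fixes q :: "nat \<Rightarrow> 'a::field vec"
  assumes "projective_frame d q" "\<And>k. k \<le> Suc d \<Longrightarrow> q k \<in> carrier_vec (Suc d)"
    and "m \<le> Suc d" "\<And>a. a \<le> d \<Longrightarrow> (\<Sum>k\<in>{..Suc d} - {m}. x k * q k $ a) = 0"
    and "k \<le> Suc d" "k \<noteq> m"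
  shows "x k = 0"
proof -
  have "\<forall>m\<le>Suc d. \<forall>x. (\<forall>a\<le>d. (\<Sum>k\<in>{..Suc d} - {m}. x k * q k $ a) = 0) \<longrightarrow>
       (\<forall>k\<in>{..Suc d} - {m}. x k = 0)"
    using assms(1,2) projective_frame_iff by blast
  with assms(3-) show ?thesis by blast
qed

lemma projective_frame_cong:
  assumes "projective_frame d q" "\<And>k. k \<le> Suc d \<Longrightarrow> q k \<in> carrier_vec (Suc d)"
    and "\<And>k. k \<le> Suc d \<Longrightarrow> proj_eq (q' k) (q k)"
  shows "projective_frame d q'"
proof -
  have "\<forall>k. \<exists>s. k \<le> Suc d \<longrightarrow> s \<noteq> 0 \<and> q' k = s \<cdot>\<^sub>v q k"
    using assms(3) unfolding proj_eq_def by blast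
  then obtain s where s: "\<And>k. k \<le> Suc d \<Longrightarrow> s k \<noteq> 0 \<and> q' k = s k \<cdot>\<^sub>v q k" by metis
  have q': "q' k \<in> carrier_vec (Suc d)" if "k \<le> Suc d" for k using assms(2) s that by simp
  have "\<forall>m\<le>Suc d. \<forall>x. (\<forall>a\<le>d. (\<Sum>k\<in>{..Suc d} - {m}. x k * q' k $ a) = 0) \<longrightarrow>
       (\<forall>k\<in>{..Suc d} - {m}. x k = 0)"
  proof (intro allI impI ballI)
    fix m x k
    assume m: "m \<le> Suc d" and x: "\<forall>a\<le>d. (\<Sum>k\<in>{..Suc d} - {m}. x k * q' k $ a) = 0"
      and k: "k \<in> {..Suc d} - {m}"
    have "(\<Sum>k\<in>{..Suc d} - {m}. x k * s k * q k $ a) = 0" if "a \<le> d" for a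
    proof -
      have "(\<Sum>k\<in>{..Suc d} - {m}. x k * s k * q k $ a) = (\<Sum>k\<in>{..Suc d} - {m}. x k * q' k $ a)"
        using s assms(2) that by (intro sum.cong) (auto simp: carrier_vecD[OF assms(2)])
      with x that show ?thesis by simp
    qed
    then have "x k * s k = 0"
      using projective_frame_independent[OF assms(1,2) m, of "\<lambda>k. x k * s k" k] k by auto
    with s k show "x k = 0" by auto
  qed
  then show ?thesis using projective_frame_iff q' by blast
qed

lemma frame_tail_det:
  fixes q :: "nat \<Rightarrow> 'a::field vec"
  assumes "projective_frame d q"
  shows "det (mat_of_cols (Suc d) (map (\<lambda>k. q (Suc k)) [0..<Suc d])) \<noteq> 0"
proof -
  have "filter (\<lambda>k. k \<noteq> 0) [0..<d + 2] = map Suc [0..<Suc d]"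
    by (subst upt_conv_Cons) (simp_all add: map_Suc_upt del: upt_Suc)
  then have "map q (filter (\<lambda>k. k \<noteq> 0) [0..<d + 2]) = map (\<lambda>k. q (Suc k)) [0..<Suc d]"
    by (simp add: comp_def del: upt_Suc)
  with assms have "invertible_mat (mat_of_cols (Suc d) (map (\<lambda>k. q (Suc k)) [0..<Suc d]))"
    unfolding projective_frame_def by (metis le0)
  moreover have "mat_of_cols (Suc d) (map (\<lambda>k. q (Suc k)) [0..<Suc d]) \<in> carrier_mat (Suc d) (Suc d)"
    by (rule carrier_matI) (simp_all only: mat_of_cols_carrier length_map length_upt diff_zero)
  ultimately show ?thesis using invertible_mat_iff_det by blast
qed

text \<open>
  A zero coefficient would give a linear relation between \<open>q 0\<close> and \<open>d\<close> of the other points.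
\<close>

lemma frame_coefficients_nonzero:
  fixes q :: "nat \<Rightarrow> 'a::field vec"
  assumes frame: "projective_frame d q" and q: "\<And>k. k \<le> Suc d \<Longrightarrow> q k \<in> carrier_vec (Suc d)"
    and x: "x \<in> carrier_vec (Suc d)"
      "mat_of_cols (Suc d) (map (\<lambda>k. q (Suc k)) [0..<Suc d]) *\<^sub>v x = q 0"
    and k: "k \<le> d"
  shows "x $ k \<noteq> 0"
proof
  assume zero: "x $ k = 0"
  \<comment> \<open>The coefficients of the relation, with \<open>q 0\<close> brought to the other side.\<close>
  define y where "y l = (case l of 0 \<Rightarrow> - 1 | Suc l \<Rightarrow> x $ l)" for l
  have "(\<Sum>l\<in>{..Suc d} - {Suc k}. y l * q l $ a) = 0" if a: "a \<le> d" for a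
  proof -
    have "q 0 $ a = (\<Sum>l\<le>d. x $ l * q (Suc l) $ a)"
      unfolding x(2)[symmetric] using q x a
      by (subst mat_of_cols_mult_vec) (auto intro!: sum.cong simp del: upt_Suc simp: lessThan_Suc_atMost)
    then have "(\<Sum>l\<le>Suc d. y l * q l $ a) = 0"
      by (subst sum.atMost_Suc_shift) (simp add: y_def)
    moreover have "(\<Sum>l\<le>Suc d. y l * q l $ a) =
        y (Suc k) * q (Suc k) $ a + (\<Sum>l\<in>{..Suc d} - {Suc k}. y l * q l $ a)"
      using k by (intro sum.remove) auto
    ultimately show ?thesis using zero by (simp add: y_def)
  qed
  then have "y 0 = 0"
    using projective_frame_independent[OF frame q, of "Suc k" y 0] k by auto
  then show False by (simp add: y_def)
qed

text \<open>
  Projective transformations that fix a frame are trivial, in linear form: fixing the coordinate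
  points makes the matrix diagonal, and fixing the unit point makes the diagonal entries equal.
\<close>

lemma standard_frame_eigenvectors_imp_scalar:
  fixes B :: "'a::field mat"
  assumes B: "B \<in> carrier_mat n n"
    and unit: "\<And>k. k < n \<Longrightarrow> \<exists>s. B *\<^sub>v unit_vec n k = s \<cdot>\<^sub>v unit_vec n k"
    and one: "B *\<^sub>v vec n (\<lambda>_. 1) = s \<cdot>\<^sub>v vec n (\<lambda>_. 1)"
  shows "B = s \<cdot>\<^sub>m 1\<^sub>m n"
proof (rule eq_matI)
  have off: "B $$ (i, j) = 0" if ij: "i < n" "j < n" "i \<noteq> j" for i j
  proof -
    obtain r where "B *\<^sub>v unit_vec n j = r \<cdot>\<^sub>v unit_vec n j" using unit ij by blast
    then have "col B j $ i = (r \<cdot>\<^sub>v unit_vec n j) $ i"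
      using mult_unit_vec_eq_col[OF B ij(2)] by simp
    then show ?thesis using B ij by simp
  qed
  fix i j assume "i < dim_row (s \<cdot>\<^sub>m 1\<^sub>m n)" "j < dim_col (s \<cdot>\<^sub>m 1\<^sub>m n)"
  then have ij: "i < n" "j < n" by auto
  have "s = (B *\<^sub>v vec n (\<lambda>_. 1)) $ i" unfolding one using ij by simp
  also have "\<dots> = (\<Sum>k<n. B $$ (i, k))"
    using B ij by (simp add: scalar_prod_def atLeast0LessThan)
  also have "\<dots> = B $$ (i, i)"
    using off ij by (subst sum.remove[of _ i]) (auto intro!: sum.neutral)
  finally show "B $$ (i, j) = (s \<cdot>\<^sub>m 1\<^sub>m n) $$ (i, j)"
    using off ij by auto
qed (use B in auto)

lemma frame_eigenvectors_imp_scalar: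
  fixes Z W :: "'a::field mat"
  assumes Z: "Z \<in> carrier_mat n n" and W: "W \<in> carrier_mat n n" "det W \<noteq> 0"
    and unit: "\<And>k. k < n \<Longrightarrow> \<exists>s. Z *\<^sub>v (W *\<^sub>v unit_vec n k) = s \<cdot>\<^sub>v (W *\<^sub>v unit_vec n k)"
    and one: "Z *\<^sub>v (W *\<^sub>v vec n (\<lambda>_. 1)) = s \<cdot>\<^sub>v (W *\<^sub>v vec n (\<lambda>_. 1))"
  shows "Z = s \<cdot>\<^sub>m 1\<^sub>m n"
proof -
  obtain U where U: "U \<in> carrier_mat n n" "W * U = 1\<^sub>m n" "U * W = 1\<^sub>m n"
    using inverse_matE[OF W] .
  have conj: "(U * Z * W) *\<^sub>v x = r \<cdot>\<^sub>v x"
    if "x \<in> carrier_vec n" "Z *\<^sub>v (W *\<^sub>v x) = r \<cdot>\<^sub>v (W *\<^sub>v x)" for x r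
  proof -
    have "(U * Z * W) *\<^sub>v x = U *\<^sub>v (Z *\<^sub>v (W *\<^sub>v x))"
      using U(1) Z W(1) that(1) by (simp add: assoc_mult_mat_vec[of _ n n _ n])
    also have "\<dots> = r \<cdot>\<^sub>v (U *\<^sub>v (W *\<^sub>v x))"
      unfolding that(2) using U(1) W(1) that(1) by (intro mult_mat_vec) auto
    also have "U *\<^sub>v (W *\<^sub>v x) = x"
      using U W(1) that(1) by (simp flip: assoc_mult_mat_vec)
    finally show ?thesis .
  qed
  have UZW: "U * Z * W = s \<cdot>\<^sub>m 1\<^sub>m n"
  proof (rule standard_frame_eigenvectors_imp_scalar)
    show "U * Z * W \<in> carrier_mat n n" using U Z W by auto
    show "\<exists>r. (U * Z * W) *\<^sub>v unit_vec n k = r \<cdot>\<^sub>v unit_vec n k" if "k < n" for k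
      using unit[OF that] conj[of "unit_vec n k"] by auto
    show "(U * Z * W) *\<^sub>v vec n (\<lambda>_. 1) = s \<cdot>\<^sub>v vec n (\<lambda>_. 1)"
      using conj[OF _ one] by simp
  qed
  have "Z = W * U * Z * (W * U)" using U Z by simp
  also have "\<dots> = W * (U * Z) * (W * U)" using U(1) Z W(1) by simp
  also have "\<dots> = W * (U * Z * (W * U))"
    using U(1) Z W(1) by (intro assoc_mult_mat) auto
  also have "U * Z * (W * U) = U * Z * W * U"
    using U(1) Z W(1) by (intro assoc_mult_mat[symmetric]) auto
  also have "U * Z * W = s \<cdot>\<^sub>m 1\<^sub>m n" by (fact UZW)
  also have "W * (s \<cdot>\<^sub>m 1\<^sub>m n * U) = s \<cdot>\<^sub>m 1\<^sub>m n"
    using U W(1) by (simp add: mult_smult_assoc_mat[of _ n n _ n] mult_smult_distrib[of _ n n _ n])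
  finally show ?thesis .
qed

text \<open>
  Both \<open>W\<close> and the inverse of \<open>A\<close> take the standard frame to the points \<open>q 0, \<dots>, q (Suc d)\<close>,
  so these two matrices agree up to a scalar. For families of points, \<open>A\<close> may have poles or degenerate
  at special values of the parameter, while \<open>W\<close> can be chosen without this defect.
\<close>

lemma next_frame_point:
  fixes A W :: "'a::field mat" and q :: "nat \<Rightarrow> 'a vec"
  assumes q: "\<And>k. k \<le> d + 2 \<Longrightarrow> q k \<in> carrier_vec (Suc d)"
    and W: "W \<in> carrier_mat (Suc d) (Suc d)" "det W \<noteq> 0" "W *\<^sub>v vec (Suc d) (\<lambda>_. 1) = q 0"
    and Wu: "\<And>k. k \<le> d \<Longrightarrow> \<exists>a. W *\<^sub>v unit_vec (Suc d) k = a \<cdot>\<^sub>v q (Suc k)"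
    and A: "A \<in> carrier_mat (Suc d) (Suc d)" "invertible_mat A"
      "proj_eq (A *\<^sub>v q 0) (vec (Suc d) (\<lambda>_. 1))"
      "\<And>k. k \<le> d \<Longrightarrow> proj_eq (A *\<^sub>v q (Suc k)) (unit_vec (Suc d) k)"
      "proj_eq (A *\<^sub>v q (d + 2)) x"
    and x: "x \<in> carrier_vec (Suc d)"
  shows "\<exists>\<gamma>. W *\<^sub>v x = \<gamma> \<cdot>\<^sub>v q (d + 2)"
proof -
  let ?n = "Suc d"
  have AW: "(A * W) *\<^sub>v y = A *\<^sub>v (W *\<^sub>v y)" if "y \<in> carrier_vec ?n" for y
    using A(1) W(1) that by (rule assoc_mult_mat_vec)
  obtain s where s: "A *\<^sub>v q 0 = s \<cdot>\<^sub>v vec ?n (\<lambda>_. 1)"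
    using A(3) unfolding proj_eq_def by blast
  have sc: "A * W = s \<cdot>\<^sub>m 1\<^sub>m ?n"
  proof (rule standard_frame_eigenvectors_imp_scalar)
    show "A * W \<in> carrier_mat ?n ?n" using A W by auto
    show "A * W *\<^sub>v vec ?n (\<lambda>_. 1) = s \<cdot>\<^sub>v vec ?n (\<lambda>_. 1)"
      using AW[of "vec ?n (\<lambda>_. 1)"] W(3) s by simp
    fix k assume "k < ?n"
    then have k: "k \<le> d" by simp
    obtain a b where ab: "W *\<^sub>v unit_vec ?n k = a \<cdot>\<^sub>v q (Suc k)" "A *\<^sub>v q (Suc k) = b \<cdot>\<^sub>v unit_vec ?n k"
      using Wu[OF k] A(4)[OF k] unfolding proj_eq_def by blast
    have "A * W *\<^sub>v unit_vec ?n k = a \<cdot>\<^sub>v (A *\<^sub>v q (Suc k))"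
      using AW[of "unit_vec ?n k"] ab(1) mult_mat_vec[OF A(1) q[of "Suc k"]] k by simp
    then show "\<exists>r. A * W *\<^sub>v unit_vec ?n k = r \<cdot>\<^sub>v unit_vec ?n k"
      unfolding ab(2) smult_smult_assoc by blast
  qed
  obtain r where r: "r \<noteq> 0" "A *\<^sub>v q (d + 2) = r \<cdot>\<^sub>v x"
    using A(5) unfolding proj_eq_def by blast
  have detA: "det A \<noteq> 0" using A(1,2) invertible_mat_iff_det by blast
  obtain B where B: "B \<in> carrier_mat ?n ?n" "B * A = 1\<^sub>m ?n"
    using inverse_matE[OF A(1) detA] by metis
  have "A *\<^sub>v (W *\<^sub>v x) = s \<cdot>\<^sub>v x"
    using AW[OF x] sc x by (simp add: smult_mat_mult_vec[of _ ?n ?n])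
  also have "\<dots> = (s / r) \<cdot>\<^sub>v (A *\<^sub>v q (d + 2))"
    unfolding r(2) using r(1) by (simp add: smult_smult_assoc)
  also have "\<dots> = A *\<^sub>v ((s / r) \<cdot>\<^sub>v q (d + 2))"
    using A(1) q by (intro mult_mat_vec[symmetric]) auto
  finally have "B *\<^sub>v (A *\<^sub>v (W *\<^sub>v x)) = B *\<^sub>v (A *\<^sub>v ((s / r) \<cdot>\<^sub>v q (d + 2)))" by simp
  then have "W *\<^sub>v x = (s / r) \<cdot>\<^sub>v q (d + 2)"
    using inverse_mult_mat_vec[OF B(1) A(1) B(2)] W(1) x q by simp
  then show ?thesis by blast
qed

section \<open>Values and derivatives of rational families\<close>

abbreviation deriv_at :: "'a::field \<Rightarrow> 'a poly fract \<Rightarrow> 'a" where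
  "deriv_at z f \<equiv> eval_at z (fam_deriv f)"

lemma regular_atE:
  assumes "regular_at z f"
  obtains N D where "f = Fraction_Field.Fract N D" "poly D z \<noteq> 0" "D \<noteq> 0"
  using assms unfolding regular_at_def by (metis poly_0)

lemma regular_at_FractI: "poly D z \<noteq> 0 \<Longrightarrow> regular_at z (Fraction_Field.Fract N D)"
  unfolding regular_at_def by blast

lemma constants_at [simp]:
  "regular_at z 0" "regular_at z 1" "eval_at z 0 = 0" "eval_at z 1 = 1"
  "deriv_at z 0 = 0" "deriv_at z 1 = 0"
proof -
  have 0: "(0 :: 'a poly fract) = Fraction_Field.Fract 0 1"
    and 1: "(1 :: 'a poly fract) = Fraction_Field.Fract 1 1"
    by (simp_all add: fract_collapse)
  show "regular_at z 0" "eval_at z 0 = 0"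
    unfolding 0 by (auto intro: regular_at_FractI simp: eval_at_Fract)
  show "regular_at z 1" "eval_at z 1 = 1"
    unfolding 1 by (auto intro: regular_at_FractI simp: eval_at_Fract)
  show "deriv_at z 0 = 0" "deriv_at z 1 = 0"
    unfolding 0 1 by (simp_all add: fam_deriv_Fract eval_at_Fract)
qed

lemma
  assumes "regular_at z f" "regular_at z g"
  shows regular_at_add: "regular_at z (f + g)"
    and eval_at_add: "eval_at z (f + g) = eval_at z f + eval_at z g"
    and deriv_at_add: "deriv_at z (f + g) = deriv_at z f + deriv_at z g"
    and regular_at_mult: "regular_at z (f * g)"
    and eval_at_mult: "eval_at z (f * g) = eval_at z f * eval_at z g"
    and deriv_at_mult:
      "deriv_at z (f * g) = deriv_at z f * eval_at z g + eval_at z f * deriv_at z g"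
proof -
  obtain N D where f: "f = Fraction_Field.Fract N D" "poly D z \<noteq> 0" "D \<noteq> 0"
    using assms(1) by (rule regular_atE)
  obtain N' D' where g: "g = Fraction_Field.Fract N' D'" "poly D' z \<noteq> 0" "D' \<noteq> 0"
    using assms(2) by (rule regular_atE)
  have sum: "f + g = Fraction_Field.Fract (N * D' + N' * D) (D * D')"
    and prod: "f * g = Fraction_Field.Fract (N * N') (D * D')"
    using f g by simp_all
  have nz: "poly (D * D') z \<noteq> 0" "D * D' \<noteq> 0" using f g by simp_all
  show "regular_at z (f + g)" "regular_at z (f * g)"
    unfolding sum prod using nz(1) by (rule regular_at_FractI)+
  show "eval_at z (f + g) = eval_at z f + eval_at z g"
    unfolding sum eval_at_Fract[OF nz(1)] using f g by (simp add: eval_at_Fract field_simps)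
  show "eval_at z (f * g) = eval_at z f * eval_at z g"
    unfolding prod eval_at_Fract[OF nz(1)] using f g by (simp add: eval_at_Fract)
  show "deriv_at z (f + g) = deriv_at z f + deriv_at z g"
    unfolding sum fam_deriv_Fract[OF nz(2)] using f g
    by (simp add: fam_deriv_Fract eval_at_Fract pderiv_mult pderiv_add)
       (simp add: divide_simps, simp add: algebra_simps power2_eq_square)
  show "deriv_at z (f * g) = deriv_at z f * eval_at z g + eval_at z f * deriv_at z g"
    unfolding prod fam_deriv_Fract[OF nz(2)] using f g
    by (simp add: fam_deriv_Fract eval_at_Fract pderiv_mult)
       (simp add: divide_simps, simp add: algebra_simps power2_eq_square)
qed

lemma regular_at_divide:
  assumes "regular_at z f" "regular_at z g" "eval_at z g \<noteq> 0"
  shows "regular_at z (f / g)"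
proof -
  obtain N D where g: "g = Fraction_Field.Fract N D" "poly D z \<noteq> 0"
    using assms(2) by (rule regular_atE)
  with assms(3) have "poly N z \<noteq> 0" by (auto simp: eval_at_Fract)
  then have "regular_at z (inverse g)"
    unfolding g(1) by (simp add: regular_at_FractI)
  then show ?thesis
    using assms(1) regular_at_mult by (simp add: field_class.field_divide_inverse)
qed

lemma
  assumes "\<And>k. k \<in> S \<Longrightarrow> regular_at z (f k)"
  shows regular_at_sum: "regular_at z (sum f S)"
    and eval_at_sum: "eval_at z (sum f S) = (\<Sum>k\<in>S. eval_at z (f k))"
    and deriv_at_sum: "deriv_at z (sum f S) = (\<Sum>k\<in>S. deriv_at z (f k))"
    and regular_at_prod: "regular_at z (prod f S)"
    and eval_at_prod: "eval_at z (prod f S) = (\<Prod>k\<in>S. eval_at z (f k))"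
proof -
  have "regular_at z (sum f S) \<and> eval_at z (sum f S) = (\<Sum>k\<in>S. eval_at z (f k)) \<and>
      deriv_at z (sum f S) = (\<Sum>k\<in>S. deriv_at z (f k)) \<and>
      regular_at z (prod f S) \<and> eval_at z (prod f S) = (\<Prod>k\<in>S. eval_at z (f k))"
    using assms
    by (induction S rule: infinite_finite_induct)
       (simp_all add: regular_at_add eval_at_add deriv_at_add regular_at_mult eval_at_mult)
  then show "regular_at z (sum f S)" "eval_at z (sum f S) = (\<Sum>k\<in>S. eval_at z (f k))"
    "deriv_at z (sum f S) = (\<Sum>k\<in>S. deriv_at z (f k))"
    "regular_at z (prod f S)" "eval_at z (prod f S) = (\<Prod>k\<in>S. eval_at z (f k))"
    by blast+
qed

definition regular_vec :: "'a::field \<Rightarrow> 'a poly fract vec \<Rightarrow> bool" where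
  "regular_vec z v \<longleftrightarrow> (\<forall>a < dim_vec v. regular_at z (v $ a))"

definition regular_mat :: "'a::field \<Rightarrow> 'a poly fract mat \<Rightarrow> bool" where
  "regular_mat z A \<longleftrightarrow> (\<forall>a < dim_row A. \<forall>b < dim_col A. regular_at z (A $$ (a, b)))"

lemma
  assumes "A \<in> carrier_mat m n" "v \<in> carrier_vec n" "regular_mat z A" "regular_vec z v"
  shows regular_mult_mat_vec: "regular_vec z (A *\<^sub>v v)"
    and eval_mult_mat_vec:
      "map_vec (eval_at z) (A *\<^sub>v v) = map_mat (eval_at z) A *\<^sub>v map_vec (eval_at z) v"
    and deriv_mult_mat_vec: "map_vec (deriv_at z) (A *\<^sub>v v) =
      map_mat (deriv_at z) A *\<^sub>v map_vec (eval_at z) v +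
      map_mat (eval_at z) A *\<^sub>v map_vec (deriv_at z) v"
proof -
  have r: "regular_at z (A $$ (a, k))" "regular_at z (v $ k)" if "a < m" "k < n" for a k
    using assms that by (auto simp: regular_mat_def regular_vec_def)
  have i: "(A *\<^sub>v v) $ a = (\<Sum>k<n. A $$ (a, k) * v $ k)" if "a < m" for a
    using assms that by (intro mult_mat_vec_index)
  show "regular_vec z (A *\<^sub>v v)"
    using assms(1) r i
    by (auto simp: regular_vec_def simp del: index_mult_mat_vec intro!: regular_at_sum regular_at_mult)
  show "map_vec (eval_at z) (A *\<^sub>v v) = map_mat (eval_at z) A *\<^sub>v map_vec (eval_at z) v"
  proof (rule eq_vecI)
    fix a assume "a < dim_vec (map_mat (eval_at z) A *\<^sub>v map_vec (eval_at z) v)"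
    then have a: "a < m" using assms by simp
    have "eval_at z ((A *\<^sub>v v) $ a) = (\<Sum>k<n. eval_at z (A $$ (a, k)) * eval_at z (v $ k))"
      unfolding i[OF a] using r[OF a]
      by (subst eval_at_sum) (auto intro!: sum.cong simp: regular_at_mult eval_at_mult)
    then show "map_vec (eval_at z) (A *\<^sub>v v) $ a =
        (map_mat (eval_at z) A *\<^sub>v map_vec (eval_at z) v) $ a"
      using assms a by (simp add: scalar_prod_def atLeast0LessThan)
  qed (use assms in simp)
  show "map_vec (deriv_at z) (A *\<^sub>v v) =
      map_mat (deriv_at z) A *\<^sub>v map_vec (eval_at z) v +
      map_mat (eval_at z) A *\<^sub>v map_vec (deriv_at z) v"
  proof (rule eq_vecI)
    fix a assume "a < dim_vec (map_mat (deriv_at z) A *\<^sub>v map_vec (eval_at z) v +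
      map_mat (eval_at z) A *\<^sub>v map_vec (deriv_at z) v)"
    then have a: "a < m" using assms by simp
    have "deriv_at z ((A *\<^sub>v v) $ a) = (\<Sum>k<n. deriv_at z (A $$ (a, k)) * eval_at z (v $ k))
        + (\<Sum>k<n. eval_at z (A $$ (a, k)) * deriv_at z (v $ k))"
      unfolding i[OF a] using r[OF a]
      by (subst deriv_at_sum)
         (auto intro!: sum.cong simp: regular_at_mult deriv_at_mult simp flip: sum.distrib)
    then show "map_vec (deriv_at z) (A *\<^sub>v v) $ a =
        (map_mat (deriv_at z) A *\<^sub>v map_vec (eval_at z) v +
         map_mat (eval_at z) A *\<^sub>v map_vec (deriv_at z) v) $ a"
      using assms a by (simp add: scalar_prod_def atLeast0LessThan)
  qed (use assms in simp)
qed

lemma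
  assumes "regular_at z k" "regular_vec z v"
  shows eval_smult_vec: "map_vec (eval_at z) (k \<cdot>\<^sub>v v) = eval_at z k \<cdot>\<^sub>v map_vec (eval_at z) v"
    and deriv_smult_vec: "map_vec (deriv_at z) (k \<cdot>\<^sub>v v) =
      deriv_at z k \<cdot>\<^sub>v map_vec (eval_at z) v + eval_at z k \<cdot>\<^sub>v map_vec (deriv_at z) v"
  using assms
  by (auto simp: regular_vec_def regular_at_mult eval_at_mult deriv_at_mult intro!: eq_vecI)

text \<open>
  Only sums and products of entries enter the Leibniz formula, and these are compatible with
  evaluation.
\<close>

lemma
  assumes "A \<in> carrier_mat n n" "regular_mat z A"
  shows regular_det: "regular_at z (det A)"
    and eval_det: "eval_at z (det A) = det (map_mat (eval_at z) A)"
proof -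
  have r: "regular_at z (A $$ (i, p i))" if "p permutes {0..<n}" "i \<in> {0..<n}" for p i
    using assms that permutes_in_image[OF that(1), of i] by (auto simp: regular_mat_def)
  have sgn: "regular_at z (signof p)" "eval_at z (signof p) = signof p" for p
  proof -
    have "(- 1 :: 'a poly fract) = Fraction_Field.Fract (- 1) 1"
      by (simp add: One_fract_def)
    then have "eval_at z (- 1) = - 1" "regular_at z (- 1)"
      by (simp_all add: eval_at_Fract regular_at_FractI)
    then show "regular_at z (signof p)" "eval_at z (signof p) = signof p"
      by (auto simp: sign_def)
  qed
  show "regular_at z (det A)"
    unfolding det_def'[OF assms(1)]
    using r sgn by (auto intro!: regular_at_sum regular_at_mult regular_at_prod)
  show "eval_at z (det A) = det (map_mat (eval_at z) A)"
    unfolding det_def'[OF assms(1)] det_def'[OF iffD2[OF map_carrier_mat assms(1)]]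
  proof (subst eval_at_sum)
    show "regular_at z (signof p * (\<Prod>i = 0..<n. A $$ (i, p i)))"
      if "p \<in> {p. p permutes {0..<n}}" for p
      using r sgn that by (auto intro!: regular_at_mult regular_at_prod)
    show "(\<Sum>p\<in>{p. p permutes {0..<n}}. eval_at z (signof p * (\<Prod>i = 0..<n. A $$ (i, p i)))) =
        (\<Sum>p\<in>{p. p permutes {0..<n}}. signof p * (\<Prod>i = 0..<n. map_mat (eval_at z) A $$ (i, p i)))"
    proof (rule sum.cong[OF refl])
      fix p assume "p \<in> {p. p permutes {0..<n}}"
      then have p: "p permutes {0..<n}" by simp
      have rp: "regular_at z (\<Prod>i = 0..<n. A $$ (i, p i))"
        using r[OF p] by (rule regular_at_prod)
      have "eval_at z (\<Prod>i = 0..<n. A $$ (i, p i)) = (\<Prod>i = 0..<n. eval_at z (A $$ (i, p i)))"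
        using r[OF p] by (rule eval_at_prod)
      also have "\<dots> = (\<Prod>i = 0..<n. map_mat (eval_at z) A $$ (i, p i))"
        using assms(1) permutes_in_image[OF p] by (intro prod.cong) auto
      finally show "eval_at z (signof p * (\<Prod>i = 0..<n. A $$ (i, p i))) =
          signof p * (\<Prod>i = 0..<n. map_mat (eval_at z) A $$ (i, p i))"
        using eval_at_mult[OF sgn(1) rp] sgn(2) by simp
    qed
  qed
qed

text \<open>
  Cramer's rule, with a denominator that does not vanish at the parameter value \<open>z\<close>.
\<close>

lemma regular_solution:
  assumes V: "V \<in> carrier_mat n n" "regular_mat z V" "det (map_mat (eval_at z) V) \<noteq> 0"
    and b: "b \<in> carrier_vec n" "regular_vec z b"
  obtains x where "x \<in> carrier_vec n" "regular_vec z x" "V *\<^sub>v x = b"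
proof -
  have ev: "eval_at z (det V) \<noteq> 0" using eval_det[OF V(1,2)] V(3) by simp
  then have "det V \<noteq> 0" by auto
  from det_non_zero_imp_unit[OF V(1) this, of "()"]
  obtain U where U: "U \<in> carrier_mat n n" "V * U = 1\<^sub>m n"
    unfolding Units_def ring_mat_def by auto
  define x where "x = U *\<^sub>v b"
  have x: "x \<in> carrier_vec n" unfolding x_def using U b by simp
  have Vx: "V *\<^sub>v x = b"
    unfolding x_def using U b V by (simp flip: assoc_mult_mat_vec)
  have "regular_at z (x $ k)" if k: "k < n" for k
  proof -
    have "x $ k = det (replace_col V b k) / det V"
      using cramer_lemma_mat[OF V(1) x k] \<open>det V \<noteq> 0\<close> unfolding Vx
      by (simp add: nonzero_eq_divide_eq)
    moreover have "regular_at z (det (replace_col V b k))"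
      using V b k
      by (intro regular_det[of _ n]) (auto simp: replace_col_def regular_mat_def regular_vec_def)
    ultimately show ?thesis
      using regular_at_divide ev regular_det[OF V(1,2)] by simp
  qed
  with x have "regular_vec z x" by (simp add: regular_vec_def)
  from that[OF x this Vx] show ?thesis .
qed

text \<open>
  The proportionality factor of two regular families is the quotient of two coordinates, and it is
  regular as soon as the denominator does not vanish at \<open>z\<close>.
\<close>

lemma regular_ratio:
  assumes eq: "u = \<gamma> \<cdot>\<^sub>v y" and "regular_vec z u" "regular_vec z y" "y \<in> carrier_vec n"
    and y: "map_vec (eval_at z) y \<noteq> 0\<^sub>v n" and u: "map_vec (eval_at z) u \<noteq> 0\<^sub>v n"
  shows "regular_at z \<gamma>" "eval_at z \<gamma> \<noteq> 0"
proof -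
  obtain a where a: "a < n" "eval_at z (y $ a) \<noteq> 0"
    using y assms(4) by (metis carrier_vecD eq_vecI index_map_vec(1,2) index_zero_vec(1,2))
  then have "y $ a \<noteq> 0" by auto
  then have "\<gamma> = u $ a / y $ a" using eq a assms(4) by simp
  moreover have "regular_at z (u $ a)" "regular_at z (y $ a)"
    using assms a by (auto simp: regular_vec_def)
  ultimately show r: "regular_at z \<gamma>" using regular_at_divide a by simp
  show "eval_at z \<gamma> \<noteq> 0"
  proof
    assume "eval_at z \<gamma> = 0"
    then have "map_vec (eval_at z) u = 0\<^sub>v n"
      unfolding eq eval_smult_vec[OF r assms(3)] using assms(4) by auto
    with u show False ..
  qed
qed

section \<open>Infinitesimal motions of families of points\<close>

text \<open>
  The homogeneous coordinates of the points of a frame can be rescaled such that \<open>q 0\<close> is the sum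
  of the others; \<open>W\<close> has the rescaled vectors as columns. The scaling factors are the coefficients
  of \<open>q 0\<close> in the basis formed by the other points. They are regular at \<open>z\<close> by Cramer's rule, and
  do not vanish there because the values at \<open>z\<close> form a frame as well.
\<close>

lemma moving_frame:
  fixes q :: "nat \<Rightarrow> 'a::field poly fract vec"
  assumes q: "\<And>k. k \<le> Suc d \<Longrightarrow> q k \<in> carrier_vec (Suc d)"
    and reg: "\<And>k. k \<le> Suc d \<Longrightarrow> regular_vec z (q k)"
    and frame: "projective_frame d (\<lambda>k. map_vec (eval_at z) (q k))"
  obtains W where "W \<in> carrier_mat (Suc d) (Suc d)" "regular_mat z W"
    "det (map_mat (eval_at z) W) \<noteq> 0" "W *\<^sub>v vec (Suc d) (\<lambda>_. 1) = q 0"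
    "\<And>k. k \<le> d \<Longrightarrow> \<exists>a. regular_at z a \<and> eval_at z a \<noteq> 0 \<and>
       W *\<^sub>v unit_vec (Suc d) k = a \<cdot>\<^sub>v q (Suc k)"
proof -
  let ?n = "Suc d"
  define V where "V = mat_of_cols ?n (map (\<lambda>k. q (Suc k)) [0..<?n])"
  have V: "V \<in> carrier_mat ?n ?n"
    unfolding V_def by (rule carrier_matI) (simp_all only: mat_of_cols_carrier length_map length_upt diff_zero)
  have V_ix: "V $$ (a, k) = q (Suc k) $ a" if "a < ?n" "k < ?n" for a k
    unfolding V_def using that by (simp add: mat_of_cols_index del: upt_Suc)
  have rq: "regular_at z (q (Suc k) $ a)" if "a < ?n" "k < ?n" for a k
    using reg[of "Suc k"] q[of "Suc k"] that by (auto simp: regular_vec_def)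
  have regV: "regular_mat z V"
    using V V_ix rq by (auto simp: regular_mat_def)
  have evV: "map_mat (eval_at z) V = mat_of_cols ?n (map (\<lambda>k. map_vec (eval_at z) (q (Suc k))) [0..<?n])"
    using V V_ix carrier_vecD[OF q[of "Suc k" for k]]
    by (intro eq_matI) (auto simp: mat_of_cols_index simp del: upt_Suc)
  have q1: "map_vec (eval_at z) (q k) \<in> carrier_vec ?n" if "k \<le> ?n" for k
    using q that by simp
  have detV: "det (map_mat (eval_at z) V) \<noteq> 0"
    unfolding evV using frame_tail_det[OF frame] .
  obtain a where a: "a \<in> carrier_vec ?n" "regular_vec z a" "V *\<^sub>v a = q 0"
    using regular_solution[OF V regV detV, of "q 0"] q reg by auto
  have "mat_of_cols ?n (map (\<lambda>k. map_vec (eval_at z) (q (Suc k))) [0..<?n]) *\<^sub>v map_vec (eval_at z) a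
      = map_vec (eval_at z) (q 0)"
    using eval_mult_mat_vec[OF V a(1) regV a(2)] unfolding evV a(3) by simp
  then have a1: "eval_at z (a $ k) \<noteq> 0" if "k \<le> d" for k
    using frame_coefficients_nonzero[OF frame q1, of "map_vec (eval_at z) a" k] a(1) that by simp
  have ra: "regular_at z (a $ k)" if "k \<le> d" for k
    using a that by (auto simp: regular_vec_def)
  define W where "W = mat ?n ?n (\<lambda>(r, k). a $ k * q (Suc k) $ r)"
  have W: "W \<in> carrier_mat ?n ?n" unfolding W_def by simp
  have Wu: "W *\<^sub>v unit_vec ?n k = a $ k \<cdot>\<^sub>v q (Suc k)" if "k \<le> d" for k
    using W that q[of "Suc k"] by (intro eq_vecI) (auto simp: mult_unit_vec_eq_col[OF W] W_def)
  have W1: "W *\<^sub>v vec ?n (\<lambda>_. 1) = q 0"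
  proof (rule eq_vecI)
    fix r assume "r < dim_vec (q 0)"
    then have r: "r < ?n" using q[of 0] by simp
    then show "(W *\<^sub>v vec ?n (\<lambda>_. 1)) $ r = q 0 $ r"
      unfolding a(3)[symmetric] mult_mat_vec_index[OF V a(1) r]
      by (subst mult_mat_vec_index[OF W]) (auto simp: W_def V_ix intro!: sum.cong)
  qed (use W q[of 0] in simp)
  have regW: "regular_mat z W"
    using ra rq by (auto simp: regular_mat_def W_def intro!: regular_at_mult)
  have "det (map_mat (eval_at z) W) \<noteq> 0"
  proof
    let ?W = "map_mat (eval_at z) W" and ?V = "map_mat (eval_at z) V"
    assume "det ?W = 0"
    then obtain x where x: "x \<in> carrier_vec ?n" "x \<noteq> 0\<^sub>v ?n" "?W *\<^sub>v x = 0\<^sub>v ?n"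
      using det_0_iff_vec_prod_zero_field[of ?W ?n] W by auto
    let ?y = "vec ?n (\<lambda>k. eval_at z (a $ k) * x $ k)"
    have "?V *\<^sub>v ?y = 0\<^sub>v ?n"
    proof (rule eq_vecI)
      fix r assume "r < dim_vec (0\<^sub>v ?n :: 'a vec)"
      then have r: "r < ?n" by simp
      have "(?V *\<^sub>v ?y) $ r = (\<Sum>k<?n. eval_at z (q (Suc k) $ r) * (eval_at z (a $ k) * x $ k))"
        using V r by (subst mult_mat_vec_index[of _ ?n ?n]) (auto simp: V_ix intro!: sum.cong)
      also have "\<dots> = (?W *\<^sub>v x) $ r"
        using W r x(1) rq ra
        by (subst mult_mat_vec_index[of _ ?n ?n])
           (auto simp: W_def eval_at_mult ac_simps intro!: sum.cong)
      finally show "(?V *\<^sub>v ?y) $ r = 0\<^sub>v ?n $ r" using x by simp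
    qed (use V in simp)
    then have y0: "?y = 0\<^sub>v ?n"
      using det_nonzero_mult_vec_nonzero[of ?V ?n ?y] V detV by auto
    have "eval_at z (a $ k) * x $ k = 0" if "k \<le> d" for k
      using arg_cong[OF y0, of "\<lambda>v. v $ k"] that by simp
    then have "x = 0\<^sub>v ?n" using x(1) a1 by (intro eq_vecI) (auto simp: less_Suc_eq_le)
    with x(2) show False ..
  qed
  then show ?thesis
    using that[OF W regW _ W1] Wu ra a1 by blast
qed

text \<open>
  The linear vector field \<open>Y\<close> on the affine space induces a vector field on the projective space.
  The condition says that the latter has at the point of the family \<open>v\<close> at time \<open>z\<close> the velocity
  of this family. The multiple of the point itself is there because tangent vectors of the projective
  space are vectors up to multiples of the base point.
\<close>

definition tracks :: "'a::field \<Rightarrow> 'a mat \<Rightarrow> 'a poly fract vec \<Rightarrow> bool" where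
  "tracks z Y v \<longleftrightarrow> (\<exists>s. Y *\<^sub>v map_vec (eval_at z) v =
     map_vec (deriv_at z) v + s \<cdot>\<^sub>v map_vec (eval_at z) v)"

lemma tracks_add_scalar:
  fixes Y :: "'a::field mat"
  assumes Y: "Y \<in> carrier_mat n n" "tracks z Y v" and v: "v \<in> carrier_vec n"
  shows "tracks z (Y + s \<cdot>\<^sub>m 1\<^sub>m n) v"
proof -
  let ?v = "map_vec (eval_at z) v"
  obtain r where r: "Y *\<^sub>v ?v = map_vec (deriv_at z) v + r \<cdot>\<^sub>v ?v"
    using Y(2) unfolding tracks_def by blast
  have "(Y + s \<cdot>\<^sub>m 1\<^sub>m n) *\<^sub>v ?v = Y *\<^sub>v ?v + s \<cdot>\<^sub>v ?v"
    using Y(1) v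
    by (subst add_mult_distrib_mat_vec[of _ n n]) (auto simp: smult_mat_mult_vec[of _ n n])
  also have "\<dots> = map_vec (deriv_at z) v + (r + s) \<cdot>\<^sub>v ?v"
    unfolding r using v by (intro eq_vecI) (auto simp: algebra_simps)
  finally show ?thesis unfolding tracks_def by blast
qed

text \<open>
  Each point of the frame is an eigenvector of the difference of \<open>Z\<close> and \<open>Y\<close>, and a linear map
  with this property is scalar. So the velocities of the points of a frame determine an element of
  the Lie algebra of the projective linear group.
\<close>

lemma tracks_frame_unique:
  fixes q :: "nat \<Rightarrow> 'a::field poly fract vec"
  assumes q: "\<And>k. k \<le> Suc d \<Longrightarrow> q k \<in> carrier_vec (Suc d)"
    and reg: "\<And>k. k \<le> Suc d \<Longrightarrow> regular_vec z (q k)"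
    and frame: "projective_frame d (\<lambda>k. map_vec (eval_at z) (q k))"
    and Y: "Y \<in> carrier_mat (Suc d) (Suc d)" "\<And>k. k \<le> Suc d \<Longrightarrow> tracks z Y (q k)"
    and Z: "Z \<in> carrier_mat (Suc d) (Suc d)" "\<And>k. k \<le> Suc d \<Longrightarrow> tracks z Z (q k)"
  obtains s where "Z = Y + s \<cdot>\<^sub>m 1\<^sub>m (Suc d)"
proof -
  let ?n = "Suc d" and ?ev = "eval_at z"
  obtain W where W: "W \<in> carrier_mat ?n ?n" "regular_mat z W" "det (map_mat ?ev W) \<noteq> 0"
    "W *\<^sub>v vec ?n (\<lambda>_. 1) = q 0"
    and Wu: "\<And>k. k \<le> d \<Longrightarrow> \<exists>a. regular_at z a \<and> ?ev a \<noteq> 0 \<and> W *\<^sub>v unit_vec ?n k = a \<cdot>\<^sub>v q (Suc k)"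
    using moving_frame[OF q reg frame] by metis
  have eig: "\<exists>s. (Z - Y) *\<^sub>v map_vec ?ev (q k) = s \<cdot>\<^sub>v map_vec ?ev (q k)" if k: "k \<le> ?n" for k
  proof -
    let ?x = "map_vec ?ev (q k)" and ?x' = "map_vec (deriv_at z) (q k)"
    obtain s r where sr: "Y *\<^sub>v ?x = ?x' + s \<cdot>\<^sub>v ?x" "Z *\<^sub>v ?x = ?x' + r \<cdot>\<^sub>v ?x"
      using Y(2) Z(2) k unfolding tracks_def by blast
    have "(Z - Y) *\<^sub>v ?x = Z *\<^sub>v ?x - Y *\<^sub>v ?x"
      using Y(1) Z(1) q[OF k] by (intro minus_mult_distrib_mat_vec) auto
    also have "\<dots> = (r - s) \<cdot>\<^sub>v ?x"
      unfolding sr using q[OF k] by (intro eq_vecI) (auto simp: algebra_simps)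
    finally show ?thesis by blast
  qed
  have evW: "map_mat ?ev W *\<^sub>v unit_vec ?n k = map_vec ?ev (W *\<^sub>v unit_vec ?n k)" if "k \<le> d" for k
  proof -
    have "regular_vec z (unit_vec ?n k)" by (auto simp: regular_vec_def unit_vec_def)
    moreover have "map_vec ?ev (unit_vec ?n k) = unit_vec ?n k" by (auto simp: unit_vec_def)
    ultimately show ?thesis using eval_mult_mat_vec[OF W(1) _ W(2)] by simp
  qed
  have ev1: "map_mat ?ev W *\<^sub>v vec ?n (\<lambda>_. 1) = map_vec ?ev (q 0)"
  proof -
    have "map_vec ?ev (W *\<^sub>v vec ?n (\<lambda>_. 1)) = map_mat ?ev W *\<^sub>v map_vec ?ev (vec ?n (\<lambda>_. 1))"
      by (intro eval_mult_mat_vec[OF W(1) _ W(2)]) (auto simp: regular_vec_def)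
    moreover have "map_vec ?ev (vec ?n (\<lambda>_. 1)) = vec ?n (\<lambda>_. 1)" by auto
    ultimately show ?thesis unfolding W(4) by (simp only:)
  qed
  obtain s where s: "(Z - Y) *\<^sub>v map_vec ?ev (q 0) = s \<cdot>\<^sub>v map_vec ?ev (q 0)" using eig by blast
  have "Z - Y = s \<cdot>\<^sub>m 1\<^sub>m ?n"
  proof (rule frame_eigenvectors_imp_scalar)
    show "Z - Y \<in> carrier_mat ?n ?n" "map_mat ?ev W \<in> carrier_mat ?n ?n" using Y Z W by auto
    show "det (map_mat ?ev W) \<noteq> 0" by fact
    show "(Z - Y) *\<^sub>v (map_mat ?ev W *\<^sub>v vec ?n (\<lambda>_. 1)) = s \<cdot>\<^sub>v (map_mat ?ev W *\<^sub>v vec ?n (\<lambda>_. 1))"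
      unfolding ev1 by (fact s)
    fix k assume "k < ?n"
    then have k: "k \<le> d" by simp
    obtain a where a: "regular_at z a" "W *\<^sub>v unit_vec ?n k = a \<cdot>\<^sub>v q (Suc k)" using Wu[OF k] by blast
    have *: "map_mat ?ev W *\<^sub>v unit_vec ?n k = ?ev a \<cdot>\<^sub>v map_vec ?ev (q (Suc k))"
      unfolding evW[OF k] a(2) using a(1) reg k by (intro eval_smult_vec) auto
    obtain r where r: "(Z - Y) *\<^sub>v map_vec ?ev (q (Suc k)) = r \<cdot>\<^sub>v map_vec ?ev (q (Suc k))"
      using eig[of "Suc k"] k by auto
    have "(Z - Y) *\<^sub>v (?ev a \<cdot>\<^sub>v map_vec ?ev (q (Suc k))) =
        ?ev a \<cdot>\<^sub>v ((Z - Y) *\<^sub>v map_vec ?ev (q (Suc k)))"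
      using q[of "Suc k"] k Y Z by (intro mult_mat_vec[of _ ?n ?n]) auto
    then show "\<exists>r. (Z - Y) *\<^sub>v (map_mat ?ev W *\<^sub>v unit_vec ?n k) =
        r \<cdot>\<^sub>v (map_mat ?ev W *\<^sub>v unit_vec ?n k)"
      unfolding * r by (auto simp: smult_smult_assoc mult.commute)
  qed
  moreover have "Z = Y + (Z - Y)" using Y(1) Z(1) by (intro eq_matI) auto
  ultimately have "Z = Y + s \<cdot>\<^sub>m 1\<^sub>m ?n"
    by (simp only:)
  then show ?thesis by (rule that)
qed

text \<open>
  The Leibniz rule applied to \<open>W x = \<gamma> y\<close>. The first matrix, the logarithmic derivative \<open>W' U\<close>,
  accounts for the motion of the image of a constant vector. The matrix \<open>L\<close> accounts for the motion
  of \<open>x\<close>; it is 0 when \<open>x\<close> is constant.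
\<close>

lemma tracks_moving_matrix:
  fixes W :: "'a::field poly fract mat" and U L :: "'a mat"
  assumes W: "W \<in> carrier_mat n n" "regular_mat z W"
    and U: "U \<in> carrier_mat n n" "U * map_mat (eval_at z) W = 1\<^sub>m n"
    and x: "x \<in> carrier_vec n" "regular_vec z x" and y: "y \<in> carrier_vec n" "regular_vec z y"
    and \<gamma>: "regular_at z \<gamma>" "eval_at z \<gamma> \<noteq> 0" and eq: "W *\<^sub>v x = \<gamma> \<cdot>\<^sub>v y"
    and L: "L \<in> carrier_mat n n"
      "L *\<^sub>v (map_mat (eval_at z) W *\<^sub>v map_vec (eval_at z) x) =
       map_mat (eval_at z) W *\<^sub>v map_vec (deriv_at z) x"
  shows "tracks z (map_mat (deriv_at z) W * U + L) y"
proof -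
  let ?W = "map_mat (eval_at z) W" and ?W' = "map_mat (deriv_at z) W"
    and ?x = "map_vec (eval_at z) x" and ?x' = "map_vec (deriv_at z) x"
    and ?y = "map_vec (eval_at z) y" and ?y' = "map_vec (deriv_at z) y"
    and ?g = "eval_at z \<gamma>" and ?g' = "deriv_at z \<gamma>"
  let ?Y = "?W' * U + L"
  have car: "?W \<in> carrier_mat n n" "?W' \<in> carrier_mat n n" "?x \<in> carrier_vec n"
    "?x' \<in> carrier_vec n" "?y \<in> carrier_vec n" "?y' \<in> carrier_vec n"
    using W x y by auto
  have e: "?W *\<^sub>v ?x = ?g \<cdot>\<^sub>v ?y"
    using eval_mult_mat_vec[OF W(1) x(1) W(2) x(2)] eval_smult_vec[OF \<gamma>(1) y(2)] eq by simp
  have d: "?W' *\<^sub>v ?x + ?W *\<^sub>v ?x' = ?g' \<cdot>\<^sub>v ?y + ?g \<cdot>\<^sub>v ?y'"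
    using deriv_mult_mat_vec[OF W(1) x(1) W(2) x(2)] deriv_smult_vec[OF \<gamma>(1) y(2)] eq by simp
  have "?g \<cdot>\<^sub>v (?Y *\<^sub>v ?y) = ?Y *\<^sub>v (?W *\<^sub>v ?x)"
    unfolding e using car U(1) L(1) by (intro mult_mat_vec[symmetric]) auto
  also have "\<dots> = ?W' *\<^sub>v (U *\<^sub>v (?W *\<^sub>v ?x)) + L *\<^sub>v (?W *\<^sub>v ?x)"
    using car U(1) L(1) by (simp add: add_mult_distrib_mat_vec[of _ n n] assoc_mult_mat_vec[of _ n n _ n])
  also have "U *\<^sub>v (?W *\<^sub>v ?x) = ?x"
    using inverse_mult_mat_vec[OF U(1) car(1) U(2) car(3)] .
  also have "?W' *\<^sub>v ?x + L *\<^sub>v (?W *\<^sub>v ?x) = ?g' \<cdot>\<^sub>v ?y + ?g \<cdot>\<^sub>v ?y'"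
    unfolding L(2) by (fact d)
  finally have main: "?g \<cdot>\<^sub>v (?Y *\<^sub>v ?y) = ?g' \<cdot>\<^sub>v ?y + ?g \<cdot>\<^sub>v ?y'" .
  have "?Y *\<^sub>v ?y = ?y' + (?g' / ?g) \<cdot>\<^sub>v ?y"
  proof (rule cancel_smult_vec[OF main \<gamma>(2)])
    show "?Y *\<^sub>v ?y \<in> carrier_vec n"
      using car U(1) L(1) by (intro mult_mat_vec_carrier[of _ n n]) auto
  qed (use car in auto)
  then show ?thesis unfolding tracks_def by blast
qed

text \<open>
  Passing from one frame of the polygon to the next. If the coordinates \<open>x\<close> of the point \<open>q (d + 2)\<close>
  were constant, the whole configuration \<open>q 0, \<dots>, q (d + 2)\<close> would be moved by the projective
  transformations that move its first \<open>d + 2\<close> points, with velocity \<open>Y\<close>. The operator \<open>L\<close>, which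
  has the points \<open>q 1, \<dots>, q (Suc d)\<close> as eigenvectors and the logarithmic derivatives of the
  coordinates as eigenvalues, does not move these points and corrects the velocity of the last one.
\<close>

lemma tracks_frame_step:
  fixes q :: "nat \<Rightarrow> 'a::field poly fract vec" and x :: "'a poly fract vec"
  assumes q: "\<And>k. k \<le> d + 2 \<Longrightarrow> q k \<in> carrier_vec (Suc d)"
    and reg: "\<And>k. k \<le> d + 2 \<Longrightarrow> regular_vec z (q k)"
    and frame: "projective_frame d (\<lambda>k. map_vec (eval_at z) (q k))"
    and last: "map_vec (eval_at z) (q (d + 2)) \<noteq> 0\<^sub>v (Suc d)"
    and A: "A \<in> carrier_mat (Suc d) (Suc d)" "invertible_mat A"
      "proj_eq (A *\<^sub>v q 0) (vec (Suc d) (\<lambda>_. 1))"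
      "\<And>k. k \<le> d \<Longrightarrow> proj_eq (A *\<^sub>v q (Suc k)) (unit_vec (Suc d) k)"
      "proj_eq (A *\<^sub>v q (d + 2)) x"
    and x: "x \<in> carrier_vec (Suc d)" "regular_vec z x" "\<And>k. k \<le> d \<Longrightarrow> eval_at z (x $ k) \<noteq> 0"
    and L: "L \<in> carrier_mat (Suc d) (Suc d)"
      "\<And>k. k \<le> d \<Longrightarrow> L *\<^sub>v map_vec (eval_at z) (q (Suc k)) =
         (deriv_at z (x $ k) / eval_at z (x $ k)) \<cdot>\<^sub>v map_vec (eval_at z) (q (Suc k))"
  obtains Y where "Y \<in> carrier_mat (Suc d) (Suc d)"
    "\<And>k. k \<le> Suc d \<Longrightarrow> tracks z Y (q k)" "\<And>k. k \<le> Suc d \<Longrightarrow> tracks z (Y + L) (q (Suc k))"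
proof -
  let ?n = "Suc d" and ?ev = "eval_at z" and ?dv = "deriv_at z"
  obtain W where W: "W \<in> carrier_mat ?n ?n" "regular_mat z W" "det (map_mat ?ev W) \<noteq> 0"
    "W *\<^sub>v vec ?n (\<lambda>_. 1) = q 0"
    and Wu: "\<And>k. k \<le> d \<Longrightarrow> \<exists>a. regular_at z a \<and> ?ev a \<noteq> 0 \<and> W *\<^sub>v unit_vec ?n k = a \<cdot>\<^sub>v q (Suc k)"
    using moving_frame[of d q z] q reg frame by (metis (no_types, lifting) add_2_eq_Suc' le_SucI)
  have W1: "map_mat ?ev W \<in> carrier_mat ?n ?n" using W(1) by simp
  obtain U where U: "U \<in> carrier_mat ?n ?n" "U * map_mat ?ev W = 1\<^sub>m ?n"
    using inverse_matE[OF W1 W(3)] by metis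
  define Y where "Y = map_mat ?dv W * U"
  have Y: "Y \<in> carrier_mat ?n ?n" unfolding Y_def using U W by auto
  \<comment> \<open>\<open>Y\<close> tracks the images under \<open>W\<close> of the points of the standard frame, which are constant.\<close>
  have const: "tracks z Y y"
    if y: "y \<in> carrier_vec ?n" "regular_vec z y" and \<gamma>: "regular_at z \<gamma>" "?ev \<gamma> \<noteq> 0"
      and x: "x \<in> carrier_vec ?n" "\<And>k. k < ?n \<Longrightarrow> x $ k = 0 \<or> x $ k = 1"
      and eq: "W *\<^sub>v x = \<gamma> \<cdot>\<^sub>v y" for x y \<gamma>
  proof -
    have "regular_at z (x $ k)" if "k < ?n" for k using x(2)[OF that] by auto
    with x(1) have rx: "regular_vec z x" by (simp add: regular_vec_def)
    have "?dv (x $ k) = 0" if "k < ?n" for k using x(2)[OF that] by auto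
    then have "map_vec ?dv x = 0\<^sub>v ?n" using x(1) by (intro eq_vecI) auto
    then have "tracks z (map_mat ?dv W * U + 0\<^sub>m ?n ?n) y"
      using W1 x(1) by (intro tracks_moving_matrix[OF W(1,2) U x(1) rx y \<gamma> eq]) auto
    then show ?thesis unfolding Y_def[symmetric] using Y by simp
  qed
  have Y0: "tracks z Y (q 0)"
    by (rule const[of "q 0" 1 "vec ?n (\<lambda>_. 1)"]) (use q reg W(4) in auto)
  have YS: "tracks z Y (q (Suc k))" if k: "k \<le> d" for k
  proof -
    obtain a where "regular_at z a" "?ev a \<noteq> 0" "W *\<^sub>v unit_vec ?n k = a \<cdot>\<^sub>v q (Suc k)"
      using Wu[OF k] by blast
    then show ?thesis
      using const[of "q (Suc k)" a "unit_vec ?n k"] q[of "Suc k"] reg[of "Suc k"] k by auto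
  qed
  \<comment> \<open>\<open>L\<close> has these points as eigenvectors, so it does not change their velocities.\<close>
  have YL: "tracks z (Y + L) (q (Suc k))" if k: "k \<le> d" for k
  proof -
    let ?y = "map_vec ?ev (q (Suc k))"
    obtain s where s: "Y *\<^sub>v ?y = map_vec ?dv (q (Suc k)) + s \<cdot>\<^sub>v ?y"
      using YS[OF k] unfolding tracks_def by blast
    have qk: "q (Suc k) \<in> carrier_vec ?n" using q k by simp
    have "(Y + L) *\<^sub>v ?y = Y *\<^sub>v ?y + L *\<^sub>v ?y"
      using Y L(1) qk by (intro add_mult_distrib_mat_vec) auto
    also have "\<dots> = map_vec ?dv (q (Suc k)) + (s + ?dv (x $ k) / ?ev (x $ k)) \<cdot>\<^sub>v ?y"
      unfolding s L(2)[OF k] using qk by (intro eq_vecI) (auto simp: algebra_simps)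
    finally show ?thesis unfolding tracks_def by blast
  qed
  \<comment> \<open>The last point is the image under \<open>W\<close> of the coordinate vector \<open>x\<close>, up to a factor.\<close>
  have Ylast: "tracks z (Y + L) (q (d + 2))"
  proof -
    have "det W \<noteq> 0"
      using W(3) eval_det[OF W(1,2)] by (metis constants_at(3))
    then obtain \<gamma> where \<gamma>: "W *\<^sub>v x = \<gamma> \<cdot>\<^sub>v q (d + 2)"
      using next_frame_point[OF q W(1) _ W(4) _ A x(1)] Wu by blast
    have x1: "map_vec ?ev x \<in> carrier_vec ?n" "map_vec ?ev x \<noteq> 0\<^sub>v ?n"
    proof -
      have "map_vec ?ev x $ 0 \<noteq> 0\<^sub>v ?n $ 0" using x(1) x(3)[of 0] by simp
      then show "map_vec ?ev x \<noteq> 0\<^sub>v ?n" by metis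
    qed (use x in simp)
    have "map_vec ?ev (W *\<^sub>v x) \<noteq> 0\<^sub>v ?n"
      unfolding eval_mult_mat_vec[OF W(1) x(1) W(2) x(2)]
      using det_nonzero_mult_vec_nonzero[OF W1 W(3) x1] .
    then have g: "regular_at z \<gamma>" "?ev \<gamma> \<noteq> 0"
      using regular_ratio[OF \<gamma> regular_mult_mat_vec[OF W(1) x(1) W(2) x(2)] reg q last] by auto
    have eig: "L *\<^sub>v (map_mat ?ev W *\<^sub>v unit_vec ?n k) =
        (?dv (x $ k) / ?ev (x $ k)) \<cdot>\<^sub>v (map_mat ?ev W *\<^sub>v unit_vec ?n k)" if "k < ?n" for k
    proof -
      have k: "k \<le> d" using that by simp
      obtain a where a: "regular_at z a" "W *\<^sub>v unit_vec ?n k = a \<cdot>\<^sub>v q (Suc k)"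
        using Wu[OF k] by blast
      have "map_vec ?ev (unit_vec ?n k) = unit_vec ?n k" by (auto simp: unit_vec_def)
      then have "map_mat ?ev W *\<^sub>v unit_vec ?n k = map_vec ?ev (W *\<^sub>v unit_vec ?n k)"
        using eval_mult_mat_vec[OF W(1) _ W(2), of "unit_vec ?n k"]
        by (auto simp: regular_vec_def unit_vec_def)
      also have "\<dots> = ?ev a \<cdot>\<^sub>v map_vec ?ev (q (Suc k))"
        unfolding a(2) using a(1) reg k by (intro eval_smult_vec) auto
      finally have *: "map_mat ?ev W *\<^sub>v unit_vec ?n k = ?ev a \<cdot>\<^sub>v map_vec ?ev (q (Suc k))" .
      have "L *\<^sub>v (?ev a \<cdot>\<^sub>v map_vec ?ev (q (Suc k))) = ?ev a \<cdot>\<^sub>v (L *\<^sub>v map_vec ?ev (q (Suc k)))"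
        using L(1) q[of "Suc k"] k by (intro mult_mat_vec) auto
      then show ?thesis
        unfolding * L(2)[OF k] by (simp add: smult_smult_assoc mult.commute)
    qed
    have "L *\<^sub>v (map_mat ?ev W *\<^sub>v map_vec ?ev x) =
        map_mat ?ev W *\<^sub>v vec ?n (\<lambda>k. ?dv (x $ k) / ?ev (x $ k) * map_vec ?ev x $ k)"
      using eigenbasis_mult_vec[OF L(1) W1 eig x1(1)] .
    also have "vec ?n (\<lambda>k. ?dv (x $ k) / ?ev (x $ k) * map_vec ?ev x $ k) = map_vec ?dv x"
      using x by (intro eq_vecI) auto
    finally show ?thesis
      unfolding Y_def using q reg by (intro tracks_moving_matrix[OF W(1,2) U x(1,2) _ _ g \<gamma> L(1)]) auto
  qed
  show ?thesis
  proof (rule that[OF Y])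
    show "tracks z Y (q k)" if "k \<le> Suc d" for k
      using Y0 YS that by (cases k) auto
    show "tracks z (Y + L) (q (Suc k))" if "k \<le> Suc d" for k
      using YL Ylast that by (cases "k = Suc d") auto
  qed
qed

text \<open>
  If \<open>y = M x\<close> projectively and \<open>M\<close> is the identity at time \<open>z\<close>, then \<open>x\<close> and \<open>y\<close> are the same point
  at this time, and their velocities differ by the derivative of \<open>M\<close>.
\<close>

lemma tracks_monodromy_image:
  fixes M :: "'a::field poly fract mat"
  assumes M: "M \<in> carrier_mat n n" "regular_mat z M"
    and scal: "map_mat (eval_at z) M = m \<cdot>\<^sub>m 1\<^sub>m n" "m \<noteq> 0"
    and x: "x \<in> carrier_vec n" "regular_vec z x" "map_vec (eval_at z) x \<noteq> 0\<^sub>v n"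
    and y: "y \<in> carrier_vec n" "regular_vec z y" "map_vec (eval_at z) y \<noteq> 0\<^sub>v n"
    and eq: "proj_eq y (M *\<^sub>v x)"
    and Y: "Y \<in> carrier_mat n n" "tracks z Y x"
  shows "tracks z (Y + inverse m \<cdot>\<^sub>m map_mat (deriv_at z) M) y"
proof -
  let ?ev = "map_vec (eval_at z)" and ?dv = "map_vec (deriv_at z)"
    and ?M' = "map_mat (deriv_at z) M"
  obtain k where k: "k \<noteq> 0" "y = k \<cdot>\<^sub>v (M *\<^sub>v x)" using eq unfolding proj_eq_def by blast
  define \<gamma> where "\<gamma> = inverse k"
  have \<gamma>: "M *\<^sub>v x = \<gamma> \<cdot>\<^sub>v y"
    unfolding k(2) \<gamma>_def using k(1) by (simp add: smult_smult_assoc)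
  have Mx: "?ev (M *\<^sub>v x) = m \<cdot>\<^sub>v ?ev x"
    unfolding eval_mult_mat_vec[OF M(1) x(1) M(2) x(2)] scal(1) using x(1)
    by (intro eq_vecI) (auto simp: smult_mat_mult_vec[of _ n n])
  have "?ev (M *\<^sub>v x) \<noteq> 0\<^sub>v n"
  proof
    assume "?ev (M *\<^sub>v x) = 0\<^sub>v n"
    then have "m * ?ev x $ a = 0" if "a < n" for a
      using that x(1) unfolding Mx by (metis carrier_vecD index_map_vec(2) index_smult_vec(1) index_zero_vec(1))
    then have "?ev x = 0\<^sub>v n" using scal(2) x(1) by (intro eq_vecI) auto
    with x(3) show False ..
  qed
  then have g: "regular_at z \<gamma>" "eval_at z \<gamma> \<noteq> 0"
    using regular_ratio[OF \<gamma> regular_mult_mat_vec[OF M(1) x(1) M(2) x(2)] y(2,1,3)] by auto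
  obtain s where s: "Y *\<^sub>v ?ev x = ?dv x + s \<cdot>\<^sub>v ?ev x" using Y(2) unfolding tracks_def by blast
  define U where "U = inverse m \<cdot>\<^sub>m (1\<^sub>m n :: 'a mat)"
  have U: "U \<in> carrier_mat n n" "U * map_mat (eval_at z) M = 1\<^sub>m n"
    unfolding U_def scal using scal(2) by (auto simp: mult_smult_distrib[of _ n n _ n] mult_smult_assoc_mat[of _ n n _ n] intro!: eq_matI)
  \<comment> \<open>The scalar \<open>s\<close> is chosen such that \<open>L\<close> maps the vector \<open>x(z)\<close> to its derivative exactly.\<close>
  define L where "L = Y - s \<cdot>\<^sub>m 1\<^sub>m n"
  have L: "L \<in> carrier_mat n n" unfolding L_def by (intro carrier_matI) auto
  have Lx: "L *\<^sub>v ?ev x = ?dv x"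
  proof -
    have "L *\<^sub>v ?ev x = Y *\<^sub>v ?ev x - s \<cdot>\<^sub>v ?ev x"
      unfolding L_def using Y(1) x(1)
      by (subst minus_mult_distrib_mat_vec[of _ n n]) (auto simp: smult_mat_mult_vec[of _ n n])
    then show ?thesis unfolding s using x(1) by (intro eq_vecI) auto
  qed
  have "tracks z (?M' * U + L) y"
  proof (rule tracks_moving_matrix[OF M U x(1,2) y(1,2) g \<gamma> L])
    have "L *\<^sub>v (map_mat (eval_at z) M *\<^sub>v ?ev x) = m \<cdot>\<^sub>v ?dv x"
      unfolding eval_mult_mat_vec[OF M(1) x(1) M(2) x(2), symmetric] Mx
      using L x(1) Lx by (subst mult_mat_vec[of _ n n]) auto
    also have "\<dots> = map_mat (eval_at z) M *\<^sub>v ?dv x"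
      unfolding scal(1) using x(1) by (simp add: smult_mat_mult_vec[of _ n n])
    finally show "L *\<^sub>v (map_mat (eval_at z) M *\<^sub>v ?ev x) = map_mat (eval_at z) M *\<^sub>v ?dv x" .
  qed
  then have "tracks z (?M' * U + L + s \<cdot>\<^sub>m 1\<^sub>m n) y"
    using M(1) U(1) L y(1) by (intro tracks_add_scalar) auto
  moreover have "?M' * U = inverse m \<cdot>\<^sub>m ?M'"
    unfolding U_def using M(1) by (simp add: mult_smult_distrib[of _ n n _ n])
  then have "?M' * U + L + s \<cdot>\<^sub>m 1\<^sub>m n = Y + inverse m \<cdot>\<^sub>m ?M'"
    unfolding L_def using Y(1) M(1) by (intro eq_matI) auto
  ultimately show ?thesis by (simp only:)
qed

section \<open>The infinitesimal monodromy\<close>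

lemma det_points_nonzero:
  fixes p :: "int \<Rightarrow> 'a::field vec"
  assumes "projective_frame d (\<lambda>k. p (int i - 1 + int k))"
  shows "det_points d p i \<noteq> 0"
proof -
  have "(\<lambda>k. p (int i - 1 + int (Suc k))) = (\<lambda>k. p (int (i + k)))"
    by (simp add: algebra_simps)
  with frame_tail_det[OF assms] show ?thesis unfolding det_points_def by simp
qed

text \<open>
  By Cramer's rule, the quotients of determinants are the coordinates of \<open>v\<close> in the basis
  \<open>p\<^sub>i, \<dots>, p\<^bsub>i+d\<^esub>\<close>. Hence one summand, with respect to \<open>i\<close>, of the formula for the infinitesimal
  monodromy is the operator that is diagonal in this basis, with eigenvalues \<open>f j\<close>.
\<close>

lemma dual_frame_operator:
  fixes p :: "int \<Rightarrow> 'a::field vec"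
  assumes p: "\<And>i. p i \<in> carrier_vec (Suc d)" and det: "det_points d p i \<noteq> 0"
  obtains L where "L \<in> carrier_mat (Suc d) (Suc d)"
    "\<And>v. v \<in> carrier_vec (Suc d) \<Longrightarrow> L *\<^sub>v v = vec (Suc d) (\<lambda>a. \<Sum>j = 0..d.
       f j * (det_replace d p i j v / det_points d p i) * p (int (i + j)) $ a)"
    "\<And>j. j \<le> d \<Longrightarrow> L *\<^sub>v p (int (i + j)) = f j \<cdot>\<^sub>v p (int (i + j))"
proof -
  let ?n = "Suc d"
  define V where "V = mat_of_cols ?n (map (\<lambda>k. p (int (i + k))) [0..<?n])"
  have V: "V \<in> carrier_mat ?n ?n"
    unfolding V_def by (rule carrier_matI) (simp_all only: mat_of_cols_carrier length_map length_upt diff_zero)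
  have V_ix: "V $$ (a, k) = p (int (i + k)) $ a" if "a < ?n" "k < ?n" for a k
    unfolding V_def using that by (simp add: mat_of_cols_index del: upt_Suc)
  have detV: "det V = det_points d p i" unfolding V_def det_points_def ..
  with det have detV0: "det V \<noteq> 0" by simp
  obtain U where U: "U \<in> carrier_mat ?n ?n" "V * U = 1\<^sub>m ?n" "U * V = 1\<^sub>m ?n"
    using inverse_matE[OF V detV0] .
  define D where "D = mat ?n ?n (\<lambda>(a, b). if a = b then f a else 0)"
  define L where "L = V * (D * U)"
  have D: "D \<in> carrier_mat ?n ?n" and L: "L \<in> carrier_mat ?n ?n"
    unfolding L_def D_def using V U by auto
  have Lv: "L *\<^sub>v v = V *\<^sub>v vec ?n (\<lambda>j. f j * (U *\<^sub>v v) $ j)" if v: "v \<in> carrier_vec ?n" for v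
  proof -
    have "L *\<^sub>v v = V *\<^sub>v (D *\<^sub>v (U *\<^sub>v v))"
      unfolding L_def using V D U(1) v by (simp add: assoc_mult_mat_vec[of _ ?n ?n _ ?n])
    then show ?thesis
      unfolding D_def using U(1) v by (subst (asm) diagonal_mult_vec) auto
  qed
  show ?thesis
  proof (rule that[OF L])
    fix v :: "'a vec" assume v: "v \<in> carrier_vec ?n"
    have Uv: "(U *\<^sub>v v) $ j = det_replace d p i j v / det_points d p i" if j: "j < ?n" for j
    proof -
      have "V *\<^sub>v (U *\<^sub>v v) = v"
        using inverse_mult_mat_vec[OF V U(1,2) v] .
      then have "det (replace_col V v j) = (U *\<^sub>v v) $ j * det V"
        using cramer_lemma_mat[OF V, of "U *\<^sub>v v" j] U(1) v j by simp
      moreover have "replace_col V v j =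
          mat_of_cols ?n (map (\<lambda>k. if k = j then v else p (int (i + k))) [0..<?n])"
        unfolding replace_col_def using V V_ix
        by (intro eq_matI) (auto simp: mat_of_cols_index simp del: upt_Suc)
      ultimately show ?thesis
        using detV detV0 unfolding det_replace_def by (simp add: field_simps)
    qed
    show "L *\<^sub>v v = vec ?n (\<lambda>a. \<Sum>j = 0..d.
       f j * (det_replace d p i j v / det_points d p i) * p (int (i + j)) $ a)"
      unfolding Lv[OF v]
    proof (rule eq_vecI)
      fix a assume "a < dim_vec (vec ?n (\<lambda>a. \<Sum>j = 0..d.
        f j * (det_replace d p i j v / det_points d p i) * p (int (i + j)) $ a))"
      then have a: "a < ?n" by simp
      have "(V *\<^sub>v vec ?n (\<lambda>j. f j * (U *\<^sub>v v) $ j)) $ a =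
          (\<Sum>j<?n. V $$ (a, j) * (f j * (U *\<^sub>v v) $ j))"
        using V a by (subst mult_mat_vec_index[of _ ?n ?n]) auto
      also have "\<dots> = (\<Sum>j<?n. f j * (det_replace d p i j v / det_points d p i) * p (int (i + j)) $ a)"
        using a by (intro sum.cong) (auto simp: V_ix Uv simp del: index_mult_mat_vec)
      finally show "(V *\<^sub>v vec ?n (\<lambda>j. f j * (U *\<^sub>v v) $ j)) $ a = vec ?n (\<lambda>a. \<Sum>j = 0..d.
          f j * (det_replace d p i j v / det_points d p i) * p (int (i + j)) $ a) $ a"
        using a by (simp only: index_vec lessThan_Suc_atMost atMost_atLeast0)
    qed (use V in simp)
  next
    fix j assume "j \<le> d"
    then have j: "j < ?n" by simp
    have pj: "V *\<^sub>v unit_vec ?n j = p (int (i + j))"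
      unfolding mult_unit_vec_eq_col[OF V j] using V V_ix j p[of "int (i + j)"]
      by (intro eq_vecI) auto
    then have "U *\<^sub>v p (int (i + j)) = unit_vec ?n j"
      using inverse_mult_mat_vec[OF U(1) V U(3), of "unit_vec ?n j"] by simp
    then have "L *\<^sub>v p (int (i + j)) = V *\<^sub>v vec ?n (\<lambda>k. f k * unit_vec ?n j $ k)"
      using Lv[OF p] by simp
    also have "vec ?n (\<lambda>k. f k * unit_vec ?n j $ k) = f j \<cdot>\<^sub>v unit_vec ?n j"
      by (intro eq_vecI) (auto simp: unit_vec_def)
    also have "V *\<^sub>v (f j \<cdot>\<^sub>v unit_vec ?n j) = f j \<cdot>\<^sub>v p (int (i + j))"
      using mult_mat_vec[OF V, of "unit_vec ?n j" "f j"] pj by simp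
    finally show "L *\<^sub>v p (int (i + j)) = f j \<cdot>\<^sub>v p (int (i + j))" .
  qed
qed

theorem theorem2p10:
  fixes d n :: nat
    and T :: "'a::field rational_polygon_map"
    and \<rho> :: "nat \<Rightarrow> nat \<Rightarrow> 'a ratfun"
    and p :: "int \<Rightarrow> 'a vec" and M :: "'a mat"
    and c :: "nat \<Rightarrow> nat \<Rightarrow> 'a"
    and C :: "nat \<Rightarrow> nat \<Rightarrow> 'a poly fract"
    and pt :: "int \<Rightarrow> 'a poly fract vec" and Mt :: "'a poly fract mat"
  assumes "polygonal_transformation d n T"
    and "scaling_symmetry d n T \<rho>"
    and "closed_ngon d n (p, M)"
    and "has_coords d n (p, M) c"
    and "deformation d n \<rho> c C"
    and "lift_of_deformation d n (p, M) C (pt, Mt)"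
  shows "\<exists>s. \<forall>v \<in> carrier_vec (Suc d).
           tangent_at_identity Mt *\<^sub>v v = monodromy_formula d n p C v + s \<cdot>\<^sub>v v"
proof -
  let ?n = "Suc d" and ?ev = "map_vec (eval_at 1)"
  have p: "p i \<in> carrier_vec ?n" "p i \<noteq> 0\<^sub>v ?n" "projective_frame d (\<lambda>k. p (i + int k))" for i
    using assms(3) unfolding closed_ngon_def ngon_def by auto
  have n: "n \<ge> 1" and pt: "pt i \<in> carrier_vec ?n"
    and Mt: "Mt \<in> carrier_mat ?n ?n"
    and mono: "proj_eq (pt (i + int n)) (Mt *\<^sub>v pt i)" for i
    using assms(6) unfolding lift_of_deformation_def ngon_def by auto
  have reg: "regular_vec 1 (pt i)" for i
    using assms(6) pt[of i] unfolding lift_of_deformation_def regular_vec_def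
    by (auto simp: less_Suc_eq_le)
  have regM: "regular_mat 1 Mt"
    using assms(6) Mt unfolding lift_of_deformation_def regular_mat_def
    by (auto simp: less_Suc_eq_le)
  have pt1: "proj_eq (?ev (pt i)) (p i)" for i
    using assms(6) unfolding lift_of_deformation_def polygon_eq_def by auto
  have pt1_nz: "?ev (pt i) \<noteq> 0\<^sub>v ?n" for i
  proof
    assume "?ev (pt i) = 0\<^sub>v ?n"
    then obtain k where k: "k \<noteq> 0" "0\<^sub>v ?n = k \<cdot>\<^sub>v p i" using pt1 unfolding proj_eq_def by metis
    have "p i = 0\<^sub>v ?n"
    proof (rule eq_vecI)
      fix a assume "a < dim_vec (0\<^sub>v ?n :: 'a vec)"
      then show "p i $ a = 0\<^sub>v ?n $ a"
        using arg_cong[OF k(2), of "\<lambda>v. v $ a"] k(1) p(1)[of i] by simp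
    qed (use p(1)[of i] in simp)
    with p(2) show False by blast
  qed
  have frame: "projective_frame d (\<lambda>k. ?ev (pt (i + int k)))" for i
    using p(3)[of i] by (rule projective_frame_cong) (use p(1) pt1 in auto)
  obtain m where m: "m \<noteq> 0" "map_mat (eval_at 1) Mt = m \<cdot>\<^sub>m 1\<^sub>m ?n"
  proof -
    obtain k where k: "k \<noteq> 0" "map_mat (eval_at 1) Mt = k \<cdot>\<^sub>m M"
      using assms(6) unfolding lift_of_deformation_def polygon_eq_def proj_eq_mat_def by auto
    obtain k' where "k' \<noteq> 0" "M = k' \<cdot>\<^sub>m 1\<^sub>m ?n"
      using assms(3) unfolding closed_ngon_def proj_eq_mat_def by auto
    with k show ?thesis by (intro that[of "k * k'"]) (auto intro!: eq_matI)
  qed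
  have tangent: "tangent_at_identity Mt = inverse m \<cdot>\<^sub>m map_mat (deriv_at 1) Mt"
  proof -
    have "eval_at 1 (Mt $$ (0, 0)) = map_mat (eval_at 1) Mt $$ (0, 0)" using Mt by simp
    also have "\<dots> = m" unfolding m(2) by simp
    finally show ?thesis unfolding tangent_at_identity_def by simp
  qed
  have C: "regular_at 1 (C i j)" "eval_at 1 (C i j) \<noteq> 0" if "i \<in> {1..n}" "j \<in> {1..?n}" for i j
    using assms(5) that unfolding deformation_def by auto
  have coords: "\<exists>A \<in> carrier_mat ?n ?n. invertible_mat A \<and>
        proj_eq (A *\<^sub>v pt (int i - 1)) (vec ?n (\<lambda>_. 1)) \<and>
        (\<forall>k \<le> d. proj_eq (A *\<^sub>v pt (int i + int k)) (unit_vec ?n k)) \<and>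
        proj_eq (A *\<^sub>v pt (int i + int d + 1)) (vec ?n (\<lambda>k. C i (Suc k)))" if "i \<in> {1..n}" for i
    using assms(6) that unfolding lift_of_deformation_def has_coords_def by auto
  \<comment> \<open>The summand of index \<open>i\<close> in the formula, applied to \<open>v\<close>.\<close>
  define R where "R i v = vec ?n (\<lambda>a. \<Sum>j = 0..d.
       deriv_at 1 (C i (j + 1)) / eval_at 1 (C i (j + 1)) *
       (det_replace d p i j v / det_points d p i) * p (int (i + j)) $ a)" for i v
  \<comment> \<open>The frames of index \<open>i\<close> start here at the vertex \<open>i\<close>, so the coordinates of index \<open>Suc i\<close> give the
    point that follows the frame.\<close>
  have step: "\<exists>Y L. Y \<in> carrier_mat ?n ?n \<and> L \<in> carrier_mat ?n ?n \<and>
      (\<forall>v \<in> carrier_vec ?n. L *\<^sub>v v = R (Suc i) v) \<and>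
      (\<forall>k \<le> Suc d. tracks 1 Y (pt (int i + int k))) \<and>
      (\<forall>k \<le> Suc d. tracks 1 (Y + L) (pt (int (Suc i) + int k)))" if i: "i < n" for i
  proof -
    let ?f = "\<lambda>j. deriv_at 1 (C (Suc i) (j + 1)) / eval_at 1 (C (Suc i) (j + 1))"
    let ?q = "\<lambda>k. pt (int i + int k)" and ?x = "vec ?n (\<lambda>k. C (Suc i) (Suc k))"
    have det: "det_points d p (Suc i) \<noteq> 0"
      using p(3)[of "int i"] by (intro det_points_nonzero) simp
    obtain L where L: "L \<in> carrier_mat ?n ?n"
      and Lv: "\<And>v. v \<in> carrier_vec ?n \<Longrightarrow> L *\<^sub>v v = R (Suc i) v"
      and Lp: "\<And>j. j \<le> d \<Longrightarrow> L *\<^sub>v p (int (Suc i + j)) = ?f j \<cdot>\<^sub>v p (int (Suc i + j))"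
      by (rule dual_frame_operator[where p = p and i = "Suc i" and f = ?f, OF p(1) det, folded R_def]) blast
    obtain A where A: "A \<in> carrier_mat ?n ?n" "invertible_mat A"
      "proj_eq (A *\<^sub>v ?q 0) (vec ?n (\<lambda>_. 1))"
      "\<And>k. k \<le> d \<Longrightarrow> proj_eq (A *\<^sub>v ?q (Suc k)) (unit_vec ?n k)"
      "proj_eq (A *\<^sub>v ?q (d + 2)) ?x"
      using coords[of "Suc i"] i by (auto simp: algebra_simps)
    have L1: "L *\<^sub>v ?ev (?q (Suc k)) = (deriv_at 1 (?x $ k) / eval_at 1 (?x $ k)) \<cdot>\<^sub>v ?ev (?q (Suc k))"
      if k: "k \<le> d" for k
    proof -
      have ix: "int (Suc i + k) = int i + int (Suc k)" by simp
      obtain s where s: "?ev (?q (Suc k)) = s \<cdot>\<^sub>v p (int (Suc i + k))"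
        using pt1[of "int i + int (Suc k)"] unfolding proj_eq_def ix by blast
      have "L *\<^sub>v ?ev (?q (Suc k)) = s \<cdot>\<^sub>v (?f k \<cdot>\<^sub>v p (int (Suc i + k)))"
        unfolding s Lp[OF k, symmetric] using L p(1) by (rule mult_mat_vec)
      then show ?thesis
        unfolding s using k by (simp add: smult_smult_assoc mult.commute)
    qed
    have x: "?x \<in> carrier_vec ?n" "regular_vec 1 ?x" "\<And>k. k \<le> d \<Longrightarrow> eval_at 1 (?x $ k) \<noteq> 0"
      using C[of "Suc i"] i by (auto simp: regular_vec_def)
    obtain Y where Y: "Y \<in> carrier_mat ?n ?n" "\<And>k. k \<le> Suc d \<Longrightarrow> tracks 1 Y (?q k)"
      "\<And>k. k \<le> Suc d \<Longrightarrow> tracks 1 (Y + L) (?q (Suc k))"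
      by (rule tracks_frame_step[of d ?q 1 A ?x L, OF pt reg frame pt1_nz A x L L1]) blast+
    have "tracks 1 (Y + L) (pt (int (Suc i) + int k))" if "k \<le> Suc d" for k
      using Y(3)[OF that] by (simp add: algebra_simps)
    with Y(1,2) L Lv show ?thesis by blast
  qed
  obtain Y where Y: "Y \<in> carrier_mat ?n ?n" "\<And>k. k \<le> Suc d \<Longrightarrow> tracks 1 Y (pt (int k))"
    using step[of 0] n by auto
  \<comment> \<open>Adding the first \<open>l\<close> summands to \<open>Y\<close> produces an operator for the frame that starts at the
    vertex \<open>l\<close>. It agrees with the operator provided by the local step only up to a scalar.\<close>
  have "\<exists>Z \<in> carrier_mat ?n ?n.
      (\<forall>v \<in> carrier_vec ?n. Z *\<^sub>v v = Y *\<^sub>v v + monodromy_formula d l p C v) \<and>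
      (\<forall>k \<le> Suc d. tracks 1 Z (pt (int l + int k)))" if "l \<le> n" for l
    using that
  proof (induction l)
    case 0
    have "Y *\<^sub>v v + monodromy_formula d 0 p C v = Y *\<^sub>v v" if "v \<in> carrier_vec ?n" for v
      using Y(1) that by (intro eq_vecI) (auto simp: monodromy_formula_def)
    with Y show ?case by (intro bexI[of _ Y]) auto
  next
    case (Suc l)
    then obtain Z where Z: "Z \<in> carrier_mat ?n ?n"
      "\<And>v. v \<in> carrier_vec ?n \<Longrightarrow> Z *\<^sub>v v = Y *\<^sub>v v + monodromy_formula d l p C v"
      "\<And>k. k \<le> Suc d \<Longrightarrow> tracks 1 Z (pt (int l + int k))" by auto
    obtain X L where X: "X \<in> carrier_mat ?n ?n" "\<And>k. k \<le> Suc d \<Longrightarrow> tracks 1 X (pt (int l + int k))"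
      and L: "L \<in> carrier_mat ?n ?n" "\<And>v. v \<in> carrier_vec ?n \<Longrightarrow> L *\<^sub>v v = R (Suc l) v"
      and XL: "\<And>k. k \<le> Suc d \<Longrightarrow> tracks 1 (X + L) (pt (int (Suc l) + int k))"
      using step[of l] Suc.prems by auto
    obtain s where s: "Z = X + s \<cdot>\<^sub>m 1\<^sub>m ?n"
      by (rule tracks_frame_unique[of d "\<lambda>k. pt (int l + int k)" 1, OF pt reg frame X Z(1,3)]) blast+
    have ZL: "Z + L = (X + L) + s \<cdot>\<^sub>m 1\<^sub>m ?n"
      unfolding s using X(1) L(1) by (intro eq_matI) auto
    have "tracks 1 (Z + L) (pt (int (Suc l) + int k))" if "k \<le> Suc d" for k
      unfolding ZL using XL[OF that] X(1) L(1) pt by (intro tracks_add_scalar[of _ ?n]) auto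
    moreover have "(Z + L) *\<^sub>v v = Y *\<^sub>v v + monodromy_formula d (Suc l) p C v"
      if v: "v \<in> carrier_vec ?n" for v
    proof -
      have "(Z + L) *\<^sub>v v = Z *\<^sub>v v + L *\<^sub>v v"
        using Z(1) L(1) v by (rule add_mult_distrib_mat_vec)
      also have "\<dots> = Y *\<^sub>v v + monodromy_formula d l p C v + R (Suc l) v"
        using Z(2)[OF v] L(2)[OF v] by simp
      also have "\<dots> = Y *\<^sub>v v + (monodromy_formula d l p C v + R (Suc l) v)"
        using Y(1) v by (intro assoc_add_vec[of _ ?n]) (auto simp: monodromy_formula_def R_def)
      also have "monodromy_formula d l p C v + R (Suc l) v = monodromy_formula d (Suc l) p C v"
        unfolding monodromy_formula_def R_def by (intro eq_vecI) (auto simp: add.assoc)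
      finally show ?thesis .
    qed
    moreover have "Z + L \<in> carrier_mat ?n ?n" using Z(1) L(1) by simp
    ultimately show ?case by blast
  qed
  from this[OF order_refl] obtain Z where Z: "Z \<in> carrier_mat ?n ?n"
    "\<And>v. v \<in> carrier_vec ?n \<Longrightarrow> Z *\<^sub>v v = Y *\<^sub>v v + monodromy_formula d n p C v"
    "\<And>k. k \<le> Suc d \<Longrightarrow> tracks 1 Z (pt (int n + int k))" by auto
  \<comment> \<open>A second operator for the frame that starts at the vertex \<open>n\<close>, from the monodromy.\<close>
  let ?N = "inverse m \<cdot>\<^sub>m map_mat (deriv_at 1) Mt"
  have N: "?N \<in> carrier_mat ?n ?n" using Mt by simp
  have YN: "tracks 1 (Y + ?N) (pt (int n + int k))" if "k \<le> Suc d" for k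
    using mono[of "int k"] Y(2)[OF that]
    by (intro tracks_monodromy_image[OF Mt regM m(2,1) pt reg pt1_nz pt reg pt1_nz _ Y(1)])
       (auto simp: add.commute)
  have "Y + ?N \<in> carrier_mat ?n ?n" using N by simp
  from this YN obtain s where s: "Y + ?N = Z + s \<cdot>\<^sub>m 1\<^sub>m ?n"
    using tracks_frame_unique[of d "\<lambda>k. pt (int n + int k)" 1 Z "Y + ?N"] pt reg frame Z(1,3)
    by blast
  have "tangent_at_identity Mt *\<^sub>v v = monodromy_formula d n p C v + s \<cdot>\<^sub>v v"
    if v: "v \<in> carrier_vec ?n" for v
  proof -
    let ?F = "monodromy_formula d n p C v"
    have F: "?F \<in> carrier_vec ?n" unfolding monodromy_formula_def by simp
    have "Y *\<^sub>v v + ?N *\<^sub>v v = (Y + ?N) *\<^sub>v v"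
      using Y(1) N v by (rule add_mult_distrib_mat_vec[symmetric])
    also have "\<dots> = Z *\<^sub>v v + s \<cdot>\<^sub>v v"
      unfolding s using Z(1) v
      by (subst add_mult_distrib_mat_vec[of _ ?n ?n]) (auto simp: smult_mat_mult_vec[of _ ?n ?n])
    also have "\<dots> = Y *\<^sub>v v + (?F + s \<cdot>\<^sub>v v)"
      unfolding Z(2)[OF v] using Y(1) v F by (intro assoc_add_vec[of _ ?n]) auto
    finally have *: "Y *\<^sub>v v + ?N *\<^sub>v v = Y *\<^sub>v v + (?F + s \<cdot>\<^sub>v v)" .
    have "?N *\<^sub>v v = ?F + s \<cdot>\<^sub>v v"
      using * by (rule vec_add_left_cancel[of _ _ _ ?n]) (use Y(1) N v F in auto)
    then show ?thesis unfolding tangent .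
  qed
  then show ?thesis by blast
qed

end
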